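(* Let $k$ be a field, let $(\mathcal T,\Sigma,\Delta)$ be a right pretriangulated category, and let $F\colon\mathcal T\to\operatorname{fdVect}_k$ be an additive functor. Then the triple $\bigl(\operatorname{Dec}_F(\mathcal T),\widehat{\Sigma},\widehat{\Delta}\bigr)$ is right pretriangulated. Moreover, if $\bigl(\operatorname{Dec}_F(\mathcal T),\widehat{\Sigma},\widehat{\Delta}\bigr)$ satisfies (RTR4), then $(\mathcal T,\Sigma,\Delta)$ satisfies (RTR4).
   Context: Right pretriangulated categories. Let $\mathcal C$ be an additive category and $\Sigma\colon\mathcal C\to\mathcal C$ an additive endofunctor (not required to be an equivalence), called the suspension. A sextuple in $\mathcal C$ is a sequence $A\xrightarrow{f}B\xrightarrow{g}C\xrightarrow{h}\Sigma A$ with $A,B,C\in\mathcal C$. A morphism of sextuples from $A\xrightarrow{f}B\xrightarrow{g}C\xrightarrow{h}\Sigma A$ to $A'\xrightarrow{f'}B'\xrightarrow{g'}C'\xrightarrow{h'}\Sigma A'$ is a triple $(\alpha,\beta,\gamma)$ of morphisms $\alpha\colon A\to A'$, $\beta\colon B\to B'$, $\gamma\colon C\to C'$ with $\beta f=f'\alpha$, $\gamma g=g'\beta$, $(\Sigma\alpha)h=h'\gamma$; it is an isomorphism of sextuples if $\alpha,\beta,\gamma$ are isomorphisms. For a class $\nabla$ of sextuples in $\mathcal C$, whose members are called right triangles, the axioms are: (RTR1) $\nabla$ is closed under isomorphisms of sextuples; for every object $A$, the sextuple $0\to A\xrightarrow{1_A}A\to 0$ (where the last term is $\Sigma 0\cong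 0$) belongs to $\nabla$; and every morphism $f\colon A\to B$ can be completed to a sextuple $A\xrightarrow{f}B\xrightarrow{g}C\xrightarrow{h}\Sigma A$ in $\nabla$. (RTR2) If $A\xrightarrow{f}B\xrightarrow{g}C\xrightarrow{h}\Sigma A$ belongs to $\nabla$, then so does $B\xrightarrow{g}C\xrightarrow{h}\Sigma A\xrightarrow{-\Sigma f}\Sigma B$. (RTR3) Given two sextuples $A\xrightarrow{f}B\xrightarrow{g}C\xrightarrow{h}\Sigma A$ and $A'\xrightarrow{f'}B'\xrightarrow{g'}C'\xrightarrow{h'}\Sigma A'$ in $\nabla$ and morphisms $\alpha\colon A\to A'$, $\beta\colon B\to B'$ with $\beta f=f'\alpha$, there exists $\gamma\colon C\to C'$ such that $(\alpha,\beta,\gamma)$ is a morphism of sextuples. (RTR4) (right octahedral axiom) Whenever $A\xrightarrow{f}B\xrightarrow{g}C\xrightarrow{h}\Sigma A$, $A\xrightarrow{af}X\xrightarrow{d}Y\xrightarrow{e}\Sigma A$ and $B\xrightarrow{a}X\xrightarrow{b}Z\xrightarrow{c}\Sigma B$ belong to $\nabla$, there exist morphisms $s\colon C\to Y$ and $t\colon Y\to Z$ such that $sg=da$, $es=h$, $td=b$, $ct=(\Sigma f)e$, and $C\xrightarrow{s}Y\xrightarrow{t}Z\xrightarrow{(\Sigma g)c}\Sigma C$ belongs to $\nabla$. A triple $(\mathcal C,\Sigma,\nabla)$ satisfying (RTR1)--(RTR3) is called a right pretriangulated category. The decoration construction. $\operatorname{fdVect}_k$ is the category of finite-dimensional $k$-vector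 spaces. The category $\operatorname{Dec}_F(\mathcal T)$ has as objects the pairs $(X,U)$ with $X\in\mathcal T$ and $U$ a $k$-subspace of $F(X)$; a morphism $f\colon(X,U)\to(Y,V)$ is a morphism $f\colon X\to Y$ in $\mathcal T$ such that $F(f)(U)\subseteq V$, with composition as in $\mathcal T$. It is an additive category, with zero object $(0,0)$ and biproducts $(X,U)\oplus(Y,V)=(X\oplus Y,U\oplus V)$. The additive endofunctor $\widehat{\Sigma}$ of $\operatorname{Dec}_F(\mathcal T)$ is given by $\widehat{\Sigma}(X,U)=(\Sigma X,0)$ and $\widehat{\Sigma}(f)=\Sigma f$. The class $\widehat{\Delta}$ is the closure under isomorphism of sextuples of the class of all sequences $$(X,U)\xrightarrow{f}(Y,V)\xrightarrow{g}(Z,F(g)V)\xrightarrow{h}(\Sigma X,0),$$ where $X\xrightarrow{f}Y\xrightarrow{g}Z\xrightarrow{h}\Sigma X$ is in $\Delta$ and $U\subseteq F(X)$, $V\subseteq F(Y)$ are subspaces with $F(f)U\subseteq V$. (The last arrow is a morphism in $\operatorname{Dec}_F(\mathcal T)$ because $hg=0$ for every right triangle in a right pretriangulated category.) *)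

theory Defs
  imports "Jordan_Normal_Form.Missing_VectorSpace"
begin

section \<open>Additive categories and additive functors\<close>

text \<open>
  The hom-sets of a category are carried by abelian groups in the sense of HOL-Algebra:
  \<open>Hom C A B\<close> is a \<open>ring\<close> record of which only the additive part is meaningful.
  Hom-sets need not be disjoint, so composition is indexed by the three objects:
  \<open>Cmp C A B D g f\<close> is the composite \<open>g f\<close> of \<open>f : A \<rightarrow> B\<close> and \<open>g : B \<rightarrow> D\<close>.
\<close>

record ('o, 'm) cat =
  Ob :: "'o set"
  Hom :: "'o \<Rightarrow> 'o \<Rightarrow> 'm ring"
  Ident :: "'o \<Rightarrow> 'm"
  Cmp :: "'o \<Rightarrow> 'o \<Rightarrow> 'o \<Rightarrow> 'm \<Rightarrow> 'm \<Rightarrow> 'm"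

abbreviation mor :: "('o, 'm) cat \<Rightarrow> 'o \<Rightarrow> 'o \<Rightarrow> 'm set" where
  "mor C A B \<equiv> carrier (Hom C A B)"

locale preadditive_category =
  fixes C :: "('o, 'm) cat"
  assumes hom_group: "\<lbrakk>A \<in> Ob C; B \<in> Ob C\<rbrakk> \<Longrightarrow> abelian_group (Hom C A B)"
    and ident_mor: "A \<in> Ob C \<Longrightarrow> Ident C A \<in> mor C A A"
    and cmp_mor: "\<lbrakk>A \<in> Ob C; B \<in> Ob C; D \<in> Ob C; f \<in> mor C A B; g \<in> mor C B D\<rbrakk>
      \<Longrightarrow> Cmp C A B D g f \<in> mor C A D"
    and ident_left: "\<lbrakk>A \<in> Ob C; B \<in> Ob C; f \<in> mor C A B\<rbrakk> \<Longrightarrow> Cmp C A B B (Ident C B) f = f"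
    and ident_right: "\<lbrakk>A \<in> Ob C; B \<in> Ob C; f \<in> mor C A B\<rbrakk> \<Longrightarrow> Cmp C A A B f (Ident C A) = f"
    and cmp_assoc: "\<lbrakk>A \<in> Ob C; B \<in> Ob C; D \<in> Ob C; E \<in> Ob C;
        f \<in> mor C A B; g \<in> mor C B D; h \<in> mor C D E\<rbrakk>
      \<Longrightarrow> Cmp C A D E h (Cmp C A B D g f) = Cmp C A B E (Cmp C B D E h g) f"
    and cmp_add_left: "\<lbrakk>A \<in> Ob C; B \<in> Ob C; D \<in> Ob C;
        f \<in> mor C A B; g \<in> mor C B D; g' \<in> mor C B D\<rbrakk>
      \<Longrightarrow> Cmp C A B D (g \<oplus>\<^bsub>Hom C B D\<^esub> g') f = Cmp C A B D g f \<oplus>\<^bsub>Hom C A D\<^esub> Cmp C A B D g' f"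
    and cmp_add_right: "\<lbrakk>A \<in> Ob C; B \<in> Ob C; D \<in> Ob C;
        f \<in> mor C A B; f' \<in> mor C A B; g \<in> mor C B D\<rbrakk>
      \<Longrightarrow> Cmp C A B D g (f \<oplus>\<^bsub>Hom C A B\<^esub> f') = Cmp C A B D g f \<oplus>\<^bsub>Hom C A D\<^esub> Cmp C A B D g f'"

definition zero_object :: "('o, 'm) cat \<Rightarrow> 'o \<Rightarrow> bool" where
  "zero_object C Z \<longleftrightarrow>
     Z \<in> Ob C \<and> (\<forall>A \<in> Ob C. (\<exists>!f. f \<in> mor C Z A) \<and> (\<exists>!f. f \<in> mor C A Z))"

definition is_biproduct ::
  "('o, 'm) cat \<Rightarrow> 'o \<Rightarrow> 'o \<Rightarrow> 'o \<Rightarrow> 'm \<Rightarrow> 'm \<Rightarrow> 'm \<Rightarrow> 'm \<Rightarrow> bool" where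
  "is_biproduct C A B P i1 i2 p1 p2 \<longleftrightarrow>
     P \<in> Ob C \<and> i1 \<in> mor C A P \<and> i2 \<in> mor C B P \<and> p1 \<in> mor C P A \<and> p2 \<in> mor C P B \<and>
     Cmp C A P A p1 i1 = Ident C A \<and> Cmp C B P B p2 i2 = Ident C B \<and>
     Cmp C A P B p2 i1 = \<zero>\<^bsub>Hom C A B\<^esub> \<and> Cmp C B P A p1 i2 = \<zero>\<^bsub>Hom C B A\<^esub> \<and>
     Cmp C P A P i1 p1 \<oplus>\<^bsub>Hom C P P\<^esub> Cmp C P B P i2 p2 = Ident C P"

locale additive_category = preadditive_category C for C :: "('o, 'm) cat" +
  assumes ex_zero_object: "\<exists>Z. zero_object C Z"
    and ex_biproduct: "\<lbrakk>A \<in> Ob C; B \<in> Ob C\<rbrakk> \<Longrightarrow> \<exists>P i1 i2 p1 p2. is_biproduct C A B P i1 i2 p1 p2"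

definition is_iso :: "('o, 'm) cat \<Rightarrow> 'o \<Rightarrow> 'o \<Rightarrow> 'm \<Rightarrow> bool" where
  "is_iso C A B f \<longleftrightarrow> f \<in> mor C A B \<and>
     (\<exists>g \<in> mor C B A. Cmp C A B A g f = Ident C A \<and> Cmp C B A B f g = Ident C B)"

record ('o, 'm, 'p, 'n) func =
  Fob :: "'o \<Rightarrow> 'p"
  Fmor :: "'o \<Rightarrow> 'o \<Rightarrow> 'm \<Rightarrow> 'n"

locale additive_functor =
  fixes C :: "('o, 'm) cat" and D :: "('p, 'n) cat" and F :: "('o, 'm, 'p, 'n) func"
  assumes fob: "A \<in> Ob C \<Longrightarrow> Fob F A \<in> Ob D"
    and fmor: "\<lbrakk>A \<in> Ob C; B \<in> Ob C; f \<in> mor C A B\<rbrakk>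
      \<Longrightarrow> Fmor F A B f \<in> mor D (Fob F A) (Fob F B)"
    and fmor_ident: "A \<in> Ob C \<Longrightarrow> Fmor F A A (Ident C A) = Ident D (Fob F A)"
    and fmor_cmp: "\<lbrakk>A \<in> Ob C; B \<in> Ob C; E \<in> Ob C; f \<in> mor C A B; g \<in> mor C B E\<rbrakk>
      \<Longrightarrow> Fmor F A E (Cmp C A B E g f)
          = Cmp D (Fob F A) (Fob F B) (Fob F E) (Fmor F B E g) (Fmor F A B f)"
    and fmor_add: "\<lbrakk>A \<in> Ob C; B \<in> Ob C; f \<in> mor C A B; g \<in> mor C A B\<rbrakk>
      \<Longrightarrow> Fmor F A B (f \<oplus>\<^bsub>Hom C A B\<^esub> g)
          = Fmor F A B f \<oplus>\<^bsub>Hom D (Fob F A) (Fob F B)\<^esub> Fmor F A B g"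


section \<open>Right pretriangulated categories\<close>

text \<open>\<open>Sextuple A B D f g h\<close> stands for \<open>A \<rightarrow> B \<rightarrow> D \<rightarrow> \<Sigma> A\<close> with arrows \<open>f\<close>, \<open>g\<close>, \<open>h\<close>.\<close>

datatype ('o, 'm) sextuple = Sextuple 'o 'o 'o 'm 'm 'm

type_synonym ('o, 'm) endofunc = "('o, 'm, 'o, 'm) func"

fun is_sextuple :: "('o, 'm) cat \<Rightarrow> ('o, 'm) endofunc \<Rightarrow> ('o, 'm) sextuple \<Rightarrow> bool" where
  "is_sextuple C S (Sextuple A B D f g h) \<longleftrightarrow>
     A \<in> Ob C \<and> B \<in> Ob C \<and> D \<in> Ob C \<and>
     f \<in> mor C A B \<and> g \<in> mor C B D \<and> h \<in> mor C D (Fob S A)"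

fun sextuple_mor :: "('o, 'm) cat \<Rightarrow> ('o, 'm) endofunc \<Rightarrow>
    ('o, 'm) sextuple \<Rightarrow> ('o, 'm) sextuple \<Rightarrow> 'm \<Rightarrow> 'm \<Rightarrow> 'm \<Rightarrow> bool" where
  "sextuple_mor C S (Sextuple A B D f g h) (Sextuple A' B' D' f' g' h') \<alpha> \<beta> \<gamma> \<longleftrightarrow>
     \<alpha> \<in> mor C A A' \<and> \<beta> \<in> mor C B B' \<and> \<gamma> \<in> mor C D D' \<and>
     Cmp C A B B' \<beta> f = Cmp C A A' B' f' \<alpha> \<and>
     Cmp C B D D' \<gamma> g = Cmp C B B' D' g' \<beta> \<and>
     Cmp C D (Fob S A) (Fob S A') (Fmor S A A' \<alpha>) h = Cmp C D D' (Fob S A') h' \<gamma>"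

fun sextuple_iso :: "('o, 'm) cat \<Rightarrow> ('o, 'm) endofunc \<Rightarrow>
    ('o, 'm) sextuple \<Rightarrow> ('o, 'm) sextuple \<Rightarrow> 'm \<Rightarrow> 'm \<Rightarrow> 'm \<Rightarrow> bool" where
  "sextuple_iso C S (Sextuple A B D f g h) (Sextuple A' B' D' f' g' h') \<alpha> \<beta> \<gamma> \<longleftrightarrow>
     sextuple_mor C S (Sextuple A B D f g h) (Sextuple A' B' D' f' g' h') \<alpha> \<beta> \<gamma> \<and>
     is_iso C A A' \<alpha> \<and> is_iso C B B' \<beta> \<and> is_iso C D D' \<gamma>"

definition sextuples_isomorphic :: "('o, 'm) cat \<Rightarrow> ('o, 'm) endofunc \<Rightarrow>
    ('o, 'm) sextuple \<Rightarrow> ('o, 'm) sextuple \<Rightarrow> bool" where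
  "sextuples_isomorphic C S s t \<longleftrightarrow>
     is_sextuple C S s \<and> is_sextuple C S t \<and> (\<exists>\<alpha> \<beta> \<gamma>. sextuple_iso C S s t \<alpha> \<beta> \<gamma>)"

text \<open>
  No zero object is chosen, so the trivial triangle in the first axiom is required for every
  zero object.
\<close>

definition RTR1 :: "('o, 'm) cat \<Rightarrow> ('o, 'm) endofunc \<Rightarrow> ('o, 'm) sextuple set \<Rightarrow> bool" where
  "RTR1 C S T \<longleftrightarrow>
     (\<forall>s t. s \<in> T \<and> sextuples_isomorphic C S s t \<longrightarrow> t \<in> T) \<and>
     (\<forall>Z A. zero_object C Z \<and> A \<in> Ob C \<longrightarrow>
        Sextuple Z A A \<zero>\<^bsub>Hom C Z A\<^esub> (Ident C A) \<zero>\<^bsub>Hom C A (Fob S Z)\<^esub> \<in> T) \<and>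
     (\<forall>A B f. A \<in> Ob C \<and> B \<in> Ob C \<and> f \<in> mor C A B \<longrightarrow>
        (\<exists>D g h. Sextuple A B D f g h \<in> T))"

definition RTR2 :: "('o, 'm) cat \<Rightarrow> ('o, 'm) endofunc \<Rightarrow> ('o, 'm) sextuple set \<Rightarrow> bool" where
  "RTR2 C S T \<longleftrightarrow>
     (\<forall>A B D f g h. Sextuple A B D f g h \<in> T \<longrightarrow>
        Sextuple B D (Fob S A) g h (\<ominus>\<^bsub>Hom C (Fob S A) (Fob S B)\<^esub> Fmor S A B f) \<in> T)"

definition RTR3 :: "('o, 'm) cat \<Rightarrow> ('o, 'm) endofunc \<Rightarrow> ('o, 'm) sextuple set \<Rightarrow> bool" where
  "RTR3 C S T \<longleftrightarrow>
     (\<forall>A B D f g h A' B' D' f' g' h' \<alpha> \<beta>.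
        Sextuple A B D f g h \<in> T \<and> Sextuple A' B' D' f' g' h' \<in> T \<and>
        \<alpha> \<in> mor C A A' \<and> \<beta> \<in> mor C B B' \<and> Cmp C A B B' \<beta> f = Cmp C A A' B' f' \<alpha> \<longrightarrow>
        (\<exists>\<gamma> \<in> mor C D D'.
           sextuple_mor C S (Sextuple A B D f g h) (Sextuple A' B' D' f' g' h') \<alpha> \<beta> \<gamma>))"

definition RTR4 :: "('o, 'm) cat \<Rightarrow> ('o, 'm) endofunc \<Rightarrow> ('o, 'm) sextuple set \<Rightarrow> bool" where
  "RTR4 C S T \<longleftrightarrow>
     (\<forall>A B D X Y Z f g h a d e b c.
        f \<in> mor C A B \<and> a \<in> mor C B X \<and>
        Sextuple A B D f g h \<in> T \<and>
        Sextuple A X Y (Cmp C A B X a f) d e \<in> T \<and>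
        Sextuple B X Z a b c \<in> T \<longrightarrow>
        (\<exists>s \<in> mor C D Y. \<exists>t \<in> mor C Y Z.
           Cmp C B D Y s g = Cmp C B X Y d a \<and>
           Cmp C D Y (Fob S A) e s = h \<and>
           Cmp C X Y Z t d = b \<and>
           Cmp C Y Z (Fob S B) c t = Cmp C Y (Fob S A) (Fob S B) (Fmor S A B f) e \<and>
           Sextuple D Y Z s t (Cmp C Z (Fob S B) (Fob S D) (Fmor S B D g) c) \<in> T))"

locale right_pretriangulated =
  additive_category C + additive_functor C C S
  for C :: "('o, 'm) cat" and S :: "('o, 'm) endofunc" and T :: "('o, 'm) sextuple set" +
  assumes triangles: "t \<in> T \<Longrightarrow> is_sextuple C S t"
    and rtr1: "RTR1 C S T"
    and rtr2: "RTR2 C S T"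
    and rtr3: "RTR3 C S T"


section \<open>Finite-dimensional vector spaces\<close>

text \<open>
  The objects are all finite-dimensional vector spaces over \<open>K\<close> whose vectors are taken from an
  arbitrary type \<open>'v\<close>.  Linear maps are functions on the carrier, hence taken extensional.
\<close>

definition fdVect :: "('k, 'r) ring_scheme \<Rightarrow> (('k, 'v) module, 'v \<Rightarrow> 'v) cat" where
  "fdVect K = \<lparr>
     Ob = {V. vectorspace K V \<and> vectorspace.fin_dim K V},
     Hom = (\<lambda>V W. \<lparr>
       carrier = module_hom K V W \<inter> extensional (carrier V),
       mult = undefined, one = undefined,
       zero = (\<lambda>x \<in> carrier V. \<zero>\<^bsub>W\<^esub>),
       add = (\<lambda>f g. \<lambda>x \<in> carrier V. f x \<oplus>\<^bsub>W\<^esub> g x)\<rparr>),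
     Ident = (\<lambda>V. \<lambda>x \<in> carrier V. x),
     Cmp = (\<lambda>V W Y g f. compose (carrier V) g f)\<rparr>"


section \<open>The decoration construction\<close>

type_synonym ('o, 'm, 'k, 'v) vect_func = "('o, 'm, ('k, 'v) module, 'v \<Rightarrow> 'v) func"

definition Dec :: "('k, 'r) ring_scheme \<Rightarrow> ('o, 'm) cat \<Rightarrow> ('o, 'm, 'k, 'v) vect_func
    \<Rightarrow> ('o \<times> 'v set, 'm) cat" where
  "Dec K C F = \<lparr>
     Ob = {(X, U). X \<in> Ob C \<and> subspace K U (Fob F X)},
     Hom = (\<lambda>(X, U) (Y, V).
       (Hom C X Y)\<lparr>carrier := {f \<in> mor C X Y. Fmor F X Y f ` U \<subseteq> V}\<rparr>),
     Ident = (\<lambda>(X, U). Ident C X),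
     Cmp = (\<lambda>(X, U) (Y, V) (Z, W) g f. Cmp C X Y Z g f)\<rparr>"

definition Dec_susp :: "('o, 'm, 'k, 'v) vect_func \<Rightarrow> ('o, 'm) endofunc
    \<Rightarrow> ('o \<times> 'v set, 'm) endofunc" where
  "Dec_susp F S = \<lparr>
     Fob = (\<lambda>(X, U). (Fob S X, {\<zero>\<^bsub>Fob F (Fob S X)\<^esub>})),
     Fmor = (\<lambda>(X, U) (Y, V) f. Fmor S X Y f)\<rparr>"

definition decorated_triangles :: "('k, 'r) ring_scheme \<Rightarrow> ('o, 'm, 'k, 'v) vect_func
    \<Rightarrow> ('o, 'm) sextuple set \<Rightarrow> ('o \<times> 'v set, 'm) sextuple set" where
  "decorated_triangles K F T =
     {Sextuple (X, U) (Y, V) (Z, Fmor F Y Z g ` V) f g h | X U Y V Z f g h.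
        Sextuple X Y Z f g h \<in> T \<and> subspace K U (Fob F X) \<and> subspace K V (Fob F Y) \<and>
        Fmor F X Y f ` U \<subseteq> V}"

definition Dec_triangles :: "('k, 'r) ring_scheme \<Rightarrow> ('o, 'm) cat \<Rightarrow> ('o, 'm, 'k, 'v) vect_func
    \<Rightarrow> ('o, 'm) endofunc \<Rightarrow> ('o, 'm) sextuple set \<Rightarrow> ('o \<times> 'v set, 'm) sextuple set" where
  "Dec_triangles K C F S T =
     {t. \<exists>s \<in> decorated_triangles K F T. sextuples_isomorphic (Dec K C F) (Dec_susp F S) s t}"

end

theory Submission
  imports Defs
begin

text \<open>
  A decoration \<open>U \<subseteq> F(X)\<close> adds a condition to arrows but no new arrows: the decorated category has
  the composition and addition of \<open>C\<close>, and its hom-groups are subgroups of those of \<open>C\<close>.  Hence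
  every equation between decorated arrows is an equation in \<open>C\<close>, and the work lies in choosing
  decorations that make the arrows supplied by \<open>C\<close> respect subspaces.

  Additivity.  A zero object carries the decoration \<open>0\<close>, which is forced since \<open>F\<close> kills it, and a
  biproduct \<open>P\<close> of \<open>X\<close> and \<open>Y\<close> carries the vectors whose projections lie in \<open>U\<close> and in \<open>V\<close>.

  The triangle axioms.  The decorated triangles are the isomorphism closure of a generating class in
  which the third object is decorated by \<open>F(g)V\<close>.  This choice makes everything fit: rotation stays
  inside the generating class because \<open>h g = 0\<close> gives \<open>F(h)F(g)V = 0\<close>, the decoration of a
  suspension, and a filler \<open>\<gamma>\<close> found in \<open>C\<close> automatically respects the decorations because
  \<open>\<gamma> g = g' \<beta>\<close>.  That these two axioms pass from generators to their isomorphism closure is a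
  general fact (\<open>RTR2_iso_closure\<close>, \<open>RTR3_iso_closure\<close>).  The vanishing
  \<open>h g = 0\<close> is \<open>triangle_cmp_zero'\<close>.

  The octahedral axiom.  Decorating every object by \<open>0\<close> embeds \<open>C\<close> fully, taking right triangles to
  decorated ones, while forgetting decorations takes decorated triangles back to right triangles
  (\<open>Dec_triangle_underlying\<close>).  An octahedron of \<open>C\<close> is therefore completed in the decorated category
  and then read off in \<open>C\<close>.
\<close>

section \<open>Preadditive categories\<close>

context preadditive_category
begin

lemma zero_mor: "A \<in> Ob C \<Longrightarrow> B \<in> Ob C \<Longrightarrow> \<zero>\<^bsub>Hom C A B\<^esub> \<in> mor C A B"
  using hom_group[of A B] by (simp add: abelian_group_def abelian_monoid.zero_closed)

lemma cmp_zero_left: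
  assumes "A \<in> Ob C" "B \<in> Ob C" "D \<in> Ob C" "f \<in> mor C A B"
  shows "Cmp C A B D \<zero>\<^bsub>Hom C B D\<^esub> f = \<zero>\<^bsub>Hom C A D\<^esub>"
proof -
  interpret BD: abelian_group "Hom C B D" using assms hom_group by blast
  interpret AD: abelian_group "Hom C A D" using assms hom_group by blast
  let ?z = "Cmp C A B D \<zero>\<^bsub>Hom C B D\<^esub> f"
  have "?z \<in> mor C A D" using assms cmp_mor zero_mor by blast
  moreover have "?z \<oplus>\<^bsub>Hom C A D\<^esub> ?z = ?z"
    using cmp_add_left[OF assms(1-4) zero_mor zero_mor] assms by simp
  ultimately show ?thesis by (metis AD.add.l_cancel_one)
qed

lemma cmp_zero_right:
  assumes "A \<in> Ob C" "B \<in> Ob C" "D \<in> Ob C" "g \<in> mor C B D"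
  shows "Cmp C A B D g \<zero>\<^bsub>Hom C A B\<^esub> = \<zero>\<^bsub>Hom C A D\<^esub>"
proof -
  interpret AB: abelian_group "Hom C A B" using assms hom_group by blast
  interpret AD: abelian_group "Hom C A D" using assms hom_group by blast
  let ?z = "Cmp C A B D g \<zero>\<^bsub>Hom C A B\<^esub>"
  have "?z \<in> mor C A D" using assms cmp_mor zero_mor by blast
  moreover have "?z \<oplus>\<^bsub>Hom C A D\<^esub> ?z = ?z"
    using cmp_add_right[OF assms(1-3) zero_mor zero_mor assms(4)] assms by simp
  ultimately show ?thesis by (metis AD.add.l_cancel_one)
qed

lemma cmp_neg_left:
  assumes "A \<in> Ob C" "B \<in> Ob C" "D \<in> Ob C" "f \<in> mor C A B" "g \<in> mor C B D"
  shows "Cmp C A B D (\<ominus>\<^bsub>Hom C B D\<^esub> g) f = \<ominus>\<^bsub>Hom C A D\<^esub> Cmp C A B D g f"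
proof -
  interpret BD: abelian_group "Hom C B D" using assms hom_group by blast
  interpret AD: abelian_group "Hom C A D" using assms hom_group by blast
  have "Cmp C A B D (\<ominus>\<^bsub>Hom C B D\<^esub> g) f \<oplus>\<^bsub>Hom C A D\<^esub> Cmp C A B D g f = \<zero>\<^bsub>Hom C A D\<^esub>"
    using cmp_add_left[OF assms(1-4), of "\<ominus>\<^bsub>Hom C B D\<^esub> g" g] assms
    by (simp add: BD.l_neg cmp_zero_left)
  then show ?thesis using AD.minus_equality assms cmp_mor by (metis BD.a_inv_closed)
qed

lemma cmp_neg_right:
  assumes "A \<in> Ob C" "B \<in> Ob C" "D \<in> Ob C" "f \<in> mor C A B" "g \<in> mor C B D"
  shows "Cmp C A B D g (\<ominus>\<^bsub>Hom C A B\<^esub> f) = \<ominus>\<^bsub>Hom C A D\<^esub> Cmp C A B D g f"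
proof -
  interpret AB: abelian_group "Hom C A B" using assms hom_group by blast
  interpret AD: abelian_group "Hom C A D" using assms hom_group by blast
  have "Cmp C A B D g (\<ominus>\<^bsub>Hom C A B\<^esub> f) \<oplus>\<^bsub>Hom C A D\<^esub> Cmp C A B D g f = \<zero>\<^bsub>Hom C A D\<^esub>"
    using cmp_add_right[OF assms(1-3), of "\<ominus>\<^bsub>Hom C A B\<^esub> f" f g] assms
    by (simp add: AB.l_neg cmp_zero_right)
  then show ?thesis using AD.minus_equality assms cmp_mor by (metis AB.a_inv_closed)
qed

text \<open>
  An equational test for zero objects.  It makes the passage between zero objects of a category and of
  its decoration immediate, as the two have the same identities and zero arrows.
\<close>

lemma zero_object_iff:
  "zero_object C Z \<longleftrightarrow> Z \<in> Ob C \<and> Ident C Z = \<zero>\<^bsub>Hom C Z Z\<^esub>"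
proof
  assume "zero_object C Z"
  then show "Z \<in> Ob C \<and> Ident C Z = \<zero>\<^bsub>Hom C Z Z\<^esub>"
    unfolding zero_object_def using ident_mor zero_mor by blast
next
  assume Z: "Z \<in> Ob C \<and> Ident C Z = \<zero>\<^bsub>Hom C Z Z\<^esub>"
  have "f = \<zero>\<^bsub>Hom C Z A\<^esub>" if "A \<in> Ob C" "f \<in> mor C Z A" for A f
    using ident_right[of Z A f] cmp_zero_right[of Z Z A f] Z that by simp
  moreover have "f = \<zero>\<^bsub>Hom C A Z\<^esub>" if "A \<in> Ob C" "f \<in> mor C A Z" for A f
    using ident_left[of A Z f] cmp_zero_left[of A Z Z f] Z that by simp
  ultimately show "zero_object C Z"
    unfolding zero_object_def using Z zero_mor by blast
qed

lemma is_iso_ident: "A \<in> Ob C \<Longrightarrow> is_iso C A A (Ident C A)"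
  unfolding is_iso_def using ident_mor ident_left by blast

lemma is_iso_cmp:
  assumes "A \<in> Ob C" "B \<in> Ob C" "D \<in> Ob C" "is_iso C A B f" "is_iso C B D g"
  shows "is_iso C A D (Cmp C A B D g f)"
proof -
  obtain f' where f: "f \<in> mor C A B" "f' \<in> mor C B A"
      "Cmp C A B A f' f = Ident C A" "Cmp C B A B f f' = Ident C B"
    using assms unfolding is_iso_def by blast
  obtain g' where g: "g \<in> mor C B D" "g' \<in> mor C D B"
      "Cmp C B D B g' g = Ident C B" "Cmp C D B D g g' = Ident C D"
    using assms unfolding is_iso_def by blast
  have "Cmp C A D A (Cmp C D B A f' g') (Cmp C A B D g f)
      = Cmp C A B A (Cmp C B D A (Cmp C D B A f' g') g) f"
    using assms f g cmp_assoc[of A B D A f g "Cmp C D B A f' g'"] cmp_mor by simp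
  also have "Cmp C B D A (Cmp C D B A f' g') g = f'"
    using assms f g cmp_assoc[of B D B A g g' f'] ident_right by simp
  finally have 1: "Cmp C A D A (Cmp C D B A f' g') (Cmp C A B D g f) = Ident C A"
    using f by simp
  have "Cmp C D A D (Cmp C A B D g f) (Cmp C D B A f' g')
      = Cmp C D B D (Cmp C B A D (Cmp C A B D g f) f') g'"
    using assms f g cmp_assoc[of D B A D g' f' "Cmp C A B D g f"] cmp_mor by simp
  also have "Cmp C B A D (Cmp C A B D g f) f' = g"
    using assms f g cmp_assoc[of B A B D f' f g] ident_right by simp
  finally have 2: "Cmp C D A D (Cmp C A B D g f) (Cmp C D B A f' g') = Ident C D"
    using g by simp
  show ?thesis unfolding is_iso_def using 1 2 assms f g cmp_mor by blast
qed

text \<open>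
  Write \<open>f' = f' \<alpha> \<alpha>' = \<beta> f \<alpha>'\<close>, using the square, and cancel \<open>\<beta>\<close> on the left.  Applied to the three
  squares of an isomorphism of sextuples, this inverts it.
\<close>

lemma square_inverse:
  assumes "A \<in> Ob C" "B \<in> Ob C" "A' \<in> Ob C" "B' \<in> Ob C"
    and "f \<in> mor C A B" "f' \<in> mor C A' B'"
    and "\<alpha> \<in> mor C A A'" "\<alpha>' \<in> mor C A' A" "Cmp C A' A A' \<alpha> \<alpha>' = Ident C A'"
    and "\<beta> \<in> mor C B B'" "\<beta>' \<in> mor C B' B" "Cmp C B B' B \<beta>' \<beta> = Ident C B"
    and "Cmp C A B B' \<beta> f = Cmp C A A' B' f' \<alpha>"
  shows "Cmp C A' B' B \<beta>' f' = Cmp C A' A B f \<alpha>'"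
proof -
  have "f' = Cmp C A' A B' (Cmp C A A' B' f' \<alpha>) \<alpha>'"
    using assms cmp_assoc[of A' A A' B' \<alpha>' \<alpha> f'] ident_right by simp
  also have "\<dots> = Cmp C A' B B' \<beta> (Cmp C A' A B f \<alpha>')"
    using assms cmp_assoc[of A' A B B' \<alpha>' f \<beta>] by simp
  finally have "Cmp C A' B' B \<beta>' f' = Cmp C A' B' B \<beta>' (Cmp C A' B B' \<beta> (Cmp C A' A B f \<alpha>'))"
    by simp
  also have "\<dots> = Cmp C A' A B f \<alpha>'"
    using assms cmp_assoc[of A' B B' B "Cmp C A' A B f \<alpha>'" \<beta> \<beta>'] cmp_mor ident_left by simp
  finally show ?thesis .
qed

lemma square_paste:
  assumes "A \<in> Ob C" "B \<in> Ob C" "A' \<in> Ob C" "B' \<in> Ob C" "A'' \<in> Ob C" "B'' \<in> Ob C"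
    and "f \<in> mor C A B" "f' \<in> mor C A' B'" "f'' \<in> mor C A'' B''"
    and "\<alpha> \<in> mor C A A'" "\<alpha>' \<in> mor C A' A''" "\<beta> \<in> mor C B B'" "\<beta>' \<in> mor C B' B''"
    and "Cmp C A B B' \<beta> f = Cmp C A A' B' f' \<alpha>"
    and "Cmp C A' B' B'' \<beta>' f' = Cmp C A' A'' B'' f'' \<alpha>'"
  shows "Cmp C A B B'' (Cmp C B B' B'' \<beta>' \<beta>) f = Cmp C A A'' B'' f'' (Cmp C A A' A'' \<alpha>' \<alpha>)"
proof -
  have "Cmp C A B B'' (Cmp C B B' B'' \<beta>' \<beta>) f = Cmp C A B' B'' \<beta>' (Cmp C A B B' \<beta> f)"
    using assms cmp_assoc[of A B B' B'' f \<beta> \<beta>'] by simp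
  also have "\<dots> = Cmp C A A' B'' (Cmp C A' B' B'' \<beta>' f') \<alpha>"
    using assms cmp_assoc[of A A' B' B'' \<alpha> f' \<beta>'] by simp
  also have "\<dots> = Cmp C A A'' B'' f'' (Cmp C A A' A'' \<alpha>' \<alpha>)"
    using assms cmp_assoc[of A A' A'' B'' \<alpha> \<alpha>' f''] by simp
  finally show ?thesis .
qed

end


section \<open>Sextuples up to isomorphism\<close>

locale suspended_category = preadditive_category C + additive_functor C C S
  for C :: "('o, 'm) cat" and S :: "('o, 'm) endofunc"
begin

lemma is_iso_susp:
  assumes "A \<in> Ob C" "B \<in> Ob C" "is_iso C A B f"
  shows "is_iso C (Fob S A) (Fob S B) (Fmor S A B f)"
proof -
  obtain f' where f: "f \<in> mor C A B" "f' \<in> mor C B A"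
      "Cmp C A B A f' f = Ident C A" "Cmp C B A B f f' = Ident C B"
    using assms unfolding is_iso_def by blast
  have "Cmp C (Fob S A) (Fob S B) (Fob S A) (Fmor S B A f') (Fmor S A B f) = Ident C (Fob S A)"
    using fmor_cmp[of A B A f f'] f assms fmor_ident by simp
  moreover have "Cmp C (Fob S B) (Fob S A) (Fob S B) (Fmor S A B f) (Fmor S B A f')
      = Ident C (Fob S B)"
    using fmor_cmp[of B A B f' f] f assms fmor_ident by simp
  ultimately show ?thesis unfolding is_iso_def using fmor f assms by blast
qed

lemma sextuple_mor_cmp:
  assumes "is_sextuple C S (Sextuple A B D f g h)" "is_sextuple C S (Sextuple A' B' D' f' g' h')"
    and "is_sextuple C S (Sextuple A'' B'' D'' f'' g'' h'')"
    and "sextuple_mor C S (Sextuple A B D f g h) (Sextuple A' B' D' f' g' h') \<alpha> \<beta> \<gamma>"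
    and "sextuple_mor C S (Sextuple A' B' D' f' g' h') (Sextuple A'' B'' D'' f'' g'' h'') \<alpha>' \<beta>' \<gamma>'"
  shows "sextuple_mor C S (Sextuple A B D f g h) (Sextuple A'' B'' D'' f'' g'' h'')
    (Cmp C A A' A'' \<alpha>' \<alpha>) (Cmp C B B' B'' \<beta>' \<beta>) (Cmp C D D' D'' \<gamma>' \<gamma>)"
  using assms cmp_mor fmor fob
    square_paste[of A B A' B' A'' B'' f f' f'' \<alpha> \<alpha>' \<beta> \<beta>']
    square_paste[of B D B' D' B'' D'' g g' g'' \<beta> \<beta>' \<gamma> \<gamma>']
    square_paste[of D "Fob S A" D' "Fob S A'" D'' "Fob S A''" h h' h'' \<gamma> \<gamma>'
      "Fmor S A A' \<alpha>" "Fmor S A' A'' \<alpha>'"]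
  by (simp add: fmor_cmp)

lemma sextuple_iso_inverse:
  assumes "is_sextuple C S (Sextuple A B D f g h)" "is_sextuple C S (Sextuple A' B' D' f' g' h')"
    and "sextuple_iso C S (Sextuple A B D f g h) (Sextuple A' B' D' f' g' h') \<alpha> \<beta> \<gamma>"
  obtains \<alpha>' \<beta>' \<gamma>' where
    "sextuple_iso C S (Sextuple A' B' D' f' g' h') (Sextuple A B D f g h) \<alpha>' \<beta>' \<gamma>'"
    "Cmp C A' A A' \<alpha> \<alpha>' = Ident C A'" "Cmp C B' B B' \<beta> \<beta>' = Ident C B'"
proof -
  obtain \<alpha>' where a: "\<alpha> \<in> mor C A A'" "\<alpha>' \<in> mor C A' A"
      "Cmp C A A' A \<alpha>' \<alpha> = Ident C A" "Cmp C A' A A' \<alpha> \<alpha>' = Ident C A'"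
    using assms(3) unfolding sextuple_iso.simps is_iso_def by blast
  obtain \<beta>' where b: "\<beta> \<in> mor C B B'" "\<beta>' \<in> mor C B' B"
      "Cmp C B B' B \<beta>' \<beta> = Ident C B" "Cmp C B' B B' \<beta> \<beta>' = Ident C B'"
    using assms(3) unfolding sextuple_iso.simps is_iso_def by blast
  obtain \<gamma>' where c: "\<gamma> \<in> mor C D D'" "\<gamma>' \<in> mor C D' D"
      "Cmp C D D' D \<gamma>' \<gamma> = Ident C D" "Cmp C D' D D' \<gamma> \<gamma>' = Ident C D'"
    using assms(3) unfolding sextuple_iso.simps is_iso_def by blast
  have Sa: "Cmp C (Fob S A) (Fob S A') (Fob S A) (Fmor S A' A \<alpha>') (Fmor S A A' \<alpha>)
      = Ident C (Fob S A)"
    using fmor_cmp[of A A' A \<alpha> \<alpha>'] a assms(1,2) fmor_ident by simp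
  have "sextuple_mor C S (Sextuple A' B' D' f' g' h') (Sextuple A B D f g h) \<alpha>' \<beta>' \<gamma>'"
    using assms a b c Sa fob fmor
      square_inverse[of A B A' B' f f' \<alpha> \<alpha>' \<beta> \<beta>']
      square_inverse[of B D B' D' g g' \<beta> \<beta>' \<gamma> \<gamma>']
      square_inverse[of D "Fob S A" D' "Fob S A'" h h' \<gamma> \<gamma>' "Fmor S A A' \<alpha>" "Fmor S A' A \<alpha>'"]
    by simp
  then have "sextuple_iso C S (Sextuple A' B' D' f' g' h') (Sextuple A B D f g h) \<alpha>' \<beta>' \<gamma>'"
    using a b c unfolding sextuple_iso.simps is_iso_def by blast
  then show ?thesis using a b that by blast
qed

lemma sextuples_isomorphic_refl: "is_sextuple C S s \<Longrightarrow> sextuples_isomorphic C S s s"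
proof (cases s)
  case (Sextuple A B D f g h)
  assume "is_sextuple C S s"
  then have "sextuple_iso C S s s (Ident C A) (Ident C B) (Ident C D)"
    unfolding Sextuple
    by (simp add: ident_mor ident_left ident_right is_iso_ident fmor_ident fob)
  with \<open>is_sextuple C S s\<close> show ?thesis unfolding sextuples_isomorphic_def by blast
qed

lemma sextuples_isomorphic_trans:
  assumes "sextuples_isomorphic C S s t" "sextuples_isomorphic C S t u"
  shows "sextuples_isomorphic C S s u"
proof (cases s, cases t, cases u)
  fix A B D f g h A' B' D' f' g' h' A'' B'' D'' f'' g'' h''
  assume s: "s = Sextuple A B D f g h" and t: "t = Sextuple A' B' D' f' g' h'"
    and u: "u = Sextuple A'' B'' D'' f'' g'' h''"
  obtain \<alpha> \<beta> \<gamma> where 1: "sextuple_iso C S s t \<alpha> \<beta> \<gamma>"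
    using assms(1) unfolding sextuples_isomorphic_def by blast
  obtain \<alpha>' \<beta>' \<gamma>' where 2: "sextuple_iso C S t u \<alpha>' \<beta>' \<gamma>'"
    using assms(2) unfolding sextuples_isomorphic_def by blast
  have sext: "is_sextuple C S s" "is_sextuple C S t" "is_sextuple C S u"
    using assms unfolding sextuples_isomorphic_def by blast+
  have "sextuple_iso C S s u
    (Cmp C A A' A'' \<alpha>' \<alpha>) (Cmp C B B' B'' \<beta>' \<beta>) (Cmp C D D' D'' \<gamma>' \<gamma>)"
    using sextuple_mor_cmp[OF sext[unfolded s t u]] 1 2 sext is_iso_cmp
    unfolding s t u sextuple_iso.simps is_sextuple.simps by blast
  then show ?thesis using sext unfolding sextuples_isomorphic_def by blast
qed

text \<open>
  The class of decorated triangles has this form.  Treating the closure for an arbitrary class \<open>G\<close>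
  reduces the triangle axioms to statements about the generating sextuples.
\<close>

definition iso_closure :: "('o, 'm) sextuple set \<Rightarrow> ('o, 'm) sextuple set" where
  "iso_closure G = {t. \<exists>s \<in> G. sextuples_isomorphic C S s t}"

lemma in_iso_closure: "s \<in> G \<Longrightarrow> is_sextuple C S s \<Longrightarrow> s \<in> iso_closure G"
  unfolding iso_closure_def using sextuples_isomorphic_refl by blast

lemma iso_closure_closed:
  "s \<in> iso_closure G \<Longrightarrow> sextuples_isomorphic C S s t \<Longrightarrow> t \<in> iso_closure G"
  unfolding iso_closure_def using sextuples_isomorphic_trans by blast

lemma iso_closure_cases:
  assumes "Sextuple A B D f g h \<in> iso_closure G"
  obtains A' B' D' f' g' h' \<alpha> \<beta> \<gamma> where
    "Sextuple A' B' D' f' g' h' \<in> G"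
    "is_sextuple C S (Sextuple A' B' D' f' g' h')" "is_sextuple C S (Sextuple A B D f g h)"
    "sextuple_iso C S (Sextuple A' B' D' f' g' h') (Sextuple A B D f g h) \<alpha> \<beta> \<gamma>"
proof -
  obtain s \<alpha> \<beta> \<gamma> where s: "s \<in> G" "is_sextuple C S s" "is_sextuple C S (Sextuple A B D f g h)"
    "sextuple_iso C S s (Sextuple A B D f g h) \<alpha> \<beta> \<gamma>"
    using assms unfolding iso_closure_def sextuples_isomorphic_def by blast
  then show ?thesis using that by (cases s) blast
qed

text \<open>
  An isomorphism \<open>(\<alpha>, \<beta>, \<gamma>)\<close> rotates to \<open>(\<beta>, \<gamma>, \<Sigma>\<alpha>)\<close>.  Its only new square is the one with sides
  \<open>-\<Sigma>f\<close> and \<open>-\<Sigma>f'\<close>, which is the negative of the image under \<open>\<Sigma>\<close> of \<open>\<beta> f = f' \<alpha>\<close>.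
\<close>

lemma rotation_iso:
  assumes s: "is_sextuple C S (Sextuple A B D f g h)"
    and t: "is_sextuple C S (Sextuple A' B' D' f' g' h')"
    and iso: "sextuple_iso C S (Sextuple A B D f g h) (Sextuple A' B' D' f' g' h') \<alpha> \<beta> \<gamma>"
  shows "sextuples_isomorphic C S
    (Sextuple B D (Fob S A) g h (\<ominus>\<^bsub>Hom C (Fob S A) (Fob S B)\<^esub> Fmor S A B f))
    (Sextuple B' D' (Fob S A') g' h' (\<ominus>\<^bsub>Hom C (Fob S A') (Fob S B')\<^esub> Fmor S A' B' f'))"
proof -
  have ob: "A \<in> Ob C" "B \<in> Ob C" "D \<in> Ob C" "A' \<in> Ob C" "B' \<in> Ob C" "D' \<in> Ob C"
    and f: "f \<in> mor C A B" "f' \<in> mor C A' B'" and ab: "\<alpha> \<in> mor C A A'" "\<beta> \<in> mor C B B'"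
    and sq: "Cmp C A B B' \<beta> f = Cmp C A A' B' f' \<alpha>"
    using s t iso by simp_all
  have neg: "\<ominus>\<^bsub>Hom C (Fob S X) (Fob S Y)\<^esub> Fmor S X Y k \<in> mor C (Fob S X) (Fob S Y)"
    if "X \<in> Ob C" "Y \<in> Ob C" "k \<in> mor C X Y" for X Y k
    using abelian_group.a_inv_closed[OF hom_group] that fob fmor by simp
  have "Cmp C (Fob S A) (Fob S B) (Fob S B') (Fmor S B B' \<beta>)
        (\<ominus>\<^bsub>Hom C (Fob S A) (Fob S B)\<^esub> Fmor S A B f)
      = \<ominus>\<^bsub>Hom C (Fob S A) (Fob S B')\<^esub> Fmor S A B' (Cmp C A B B' \<beta> f)"
    using ob f ab fob fmor by (simp add: cmp_neg_right fmor_cmp)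
  also have "\<dots> = Cmp C (Fob S A) (Fob S A') (Fob S B')
        (\<ominus>\<^bsub>Hom C (Fob S A') (Fob S B')\<^esub> Fmor S A' B' f') (Fmor S A A' \<alpha>)"
    unfolding sq using ob f ab fob fmor by (simp add: cmp_neg_left fmor_cmp)
  finally have "sextuple_iso C S
      (Sextuple B D (Fob S A) g h (\<ominus>\<^bsub>Hom C (Fob S A) (Fob S B)\<^esub> Fmor S A B f))
      (Sextuple B' D' (Fob S A') g' h' (\<ominus>\<^bsub>Hom C (Fob S A') (Fob S B')\<^esub> Fmor S A' B' f'))
      \<beta> \<gamma> (Fmor S A A' \<alpha>)"
    using s t iso fmor is_iso_susp by simp
  then show ?thesis
    unfolding sextuples_isomorphic_def using s t neg fob
    by (intro conjI exI) (simp_all del: sextuple_iso.simps)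
qed

lemma RTR2_iso_closure:
  assumes rot: "\<And>A B D f g h. Sextuple A B D f g h \<in> G \<Longrightarrow>
    Sextuple B D (Fob S A) g h (\<ominus>\<^bsub>Hom C (Fob S A) (Fob S B)\<^esub> Fmor S A B f) \<in> iso_closure G"
  shows "RTR2 C S (iso_closure G)"
  unfolding RTR2_def
proof (intro allI impI)
  fix A B D f g h
  assume "Sextuple A B D f g h \<in> iso_closure G"
  then obtain A' B' D' f' g' h' \<alpha> \<beta> \<gamma> where s: "Sextuple A' B' D' f' g' h' \<in> G"
    "is_sextuple C S (Sextuple A' B' D' f' g' h')" "is_sextuple C S (Sextuple A B D f g h)"
    "sextuple_iso C S (Sextuple A' B' D' f' g' h') (Sextuple A B D f g h) \<alpha> \<beta> \<gamma>"
    by (rule iso_closure_cases)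
  show "Sextuple B D (Fob S A) g h (\<ominus>\<^bsub>Hom C (Fob S A) (Fob S B)\<^esub> Fmor S A B f)
      \<in> iso_closure G"
    by (rule iso_closure_closed[OF rot[OF s(1)] rotation_iso[OF s(2-4)]])
qed

text \<open>
  To fill a square between sextuples of the closure, move it to sextuples of \<open>G\<close> along the
  isomorphisms, fill it there, and move the filler back.
\<close>

lemma RTR3_iso_closure:
  assumes "RTR3 C S G"
  shows "RTR3 C S (iso_closure G)"
  unfolding RTR3_def
proof (intro allI impI, elim conjE)
  fix A B D f g h A' B' D' f' g' h' \<alpha> \<beta>
  assume s: "Sextuple A B D f g h \<in> iso_closure G"
    and s': "Sextuple A' B' D' f' g' h' \<in> iso_closure G"
    and ab: "\<alpha> \<in> mor C A A'" "\<beta> \<in> mor C B B'"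
    and sq: "Cmp C A B B' \<beta> f = Cmp C A A' B' f' \<alpha>"
  obtain A1 B1 D1 f1 g1 h1 a b c where t: "Sextuple A1 B1 D1 f1 g1 h1 \<in> G"
    "is_sextuple C S (Sextuple A1 B1 D1 f1 g1 h1)" "is_sextuple C S (Sextuple A B D f g h)"
    "sextuple_iso C S (Sextuple A1 B1 D1 f1 g1 h1) (Sextuple A B D f g h) a b c"
    using s by (rule iso_closure_cases)
  obtain A2 B2 D2 f2 g2 h2 a' b' c' where t': "Sextuple A2 B2 D2 f2 g2 h2 \<in> G"
    "is_sextuple C S (Sextuple A2 B2 D2 f2 g2 h2)" "is_sextuple C S (Sextuple A' B' D' f' g' h')"
    "sextuple_iso C S (Sextuple A2 B2 D2 f2 g2 h2) (Sextuple A' B' D' f' g' h') a' b' c'"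
    using s' by (rule iso_closure_cases)
  obtain i j k where inv:
    "sextuple_iso C S (Sextuple A B D f g h) (Sextuple A1 B1 D1 f1 g1 h1) i j k"
    "Cmp C A A1 A a i = Ident C A" "Cmp C B B1 B b j = Ident C B"
    using t(2-4) by (rule sextuple_iso_inverse)
  obtain i' j' k' where inv':
    "sextuple_iso C S (Sextuple A' B' D' f' g' h') (Sextuple A2 B2 D2 f2 g2 h2) i' j' k'"
    "Cmp C A' A2 A' a' i' = Ident C A'" "Cmp C B' B2 B' b' j' = Ident C B'"
    using t'(2-4) by (rule sextuple_iso_inverse)
  note ob = t(2,3)[unfolded is_sextuple.simps] t'(2,3)[unfolded is_sextuple.simps]
  note isos = t(4)[unfolded sextuple_iso.simps sextuple_mor.simps]
    t'(4)[unfolded sextuple_iso.simps sextuple_mor.simps]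
    inv(1)[unfolded sextuple_iso.simps sextuple_mor.simps]
    inv'(1)[unfolded sextuple_iso.simps sextuple_mor.simps]
  define \<alpha>1 where "\<alpha>1 = Cmp C A1 A A' \<alpha> a"
  define \<beta>1 where "\<beta>1 = Cmp C B1 B B' \<beta> b"
  define \<alpha>2 where "\<alpha>2 = Cmp C A1 A' A2 i' \<alpha>1"
  define \<beta>2 where "\<beta>2 = Cmp C B1 B' B2 j' \<beta>1"
  have m1: "\<alpha>1 \<in> mor C A1 A'" "\<beta>1 \<in> mor C B1 B'"
    unfolding \<alpha>1_def \<beta>1_def using cmp_mor ob isos ab by blast+
  have m2: "\<alpha>2 \<in> mor C A1 A2" "\<beta>2 \<in> mor C B1 B2"
    unfolding \<alpha>2_def \<beta>2_def using cmp_mor ob isos m1 by blast+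
  have "Cmp C A1 B1 B' \<beta>1 f1 = Cmp C A1 A' B' f' \<alpha>1"
    unfolding \<alpha>1_def \<beta>1_def by (rule square_paste[of _ _ A B _ _ _ f]) (use ob isos ab sq in auto)
  then have "Cmp C A1 B1 B2 \<beta>2 f1 = Cmp C A1 A2 B2 f2 \<alpha>2"
    unfolding \<alpha>2_def \<beta>2_def by (intro square_paste[of _ _ A' B' _ _ _ f']) (use ob isos m1 in auto)
  then obtain \<gamma>2 where g2:
    "sextuple_mor C S (Sextuple A1 B1 D1 f1 g1 h1) (Sextuple A2 B2 D2 f2 g2 h2) \<alpha>2 \<beta>2 \<gamma>2"
    using assms t(1) t'(1) m2 unfolding RTR3_def by blast
  \<comment> \<open>transporting \<open>r\<close> along the isomorphisms and back recovers \<open>r\<close>\<close>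
  have conj_back: "Cmp C X X2 X' p (Cmp C X X1 X2 (Cmp C X1 X' X2 q (Cmp C X1 X X' r u)) v) = r"
    if "X \<in> Ob C" "X1 \<in> Ob C" "X2 \<in> Ob C" "X' \<in> Ob C" "p \<in> mor C X2 X'" "q \<in> mor C X' X2"
      "r \<in> mor C X X'" "u \<in> mor C X1 X" "v \<in> mor C X X1"
      "Cmp C X' X2 X' p q = Ident C X'" "Cmp C X X1 X u v = Ident C X"
    for X X1 X2 X' p q r u v
  proof -
    have "Cmp C X X1 X2 (Cmp C X1 X' X2 q (Cmp C X1 X X' r u)) v = Cmp C X X' X2 q r"
      using that cmp_mor cmp_assoc[of X X1 X' X2 v "Cmp C X1 X X' r u" q]
        cmp_assoc[of X X1 X X' v u r] ident_right[of X X' r] by simp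
    then show ?thesis
      using that cmp_assoc[of X X' X2 X' r q p] ident_left by simp
  qed
  have "sextuple_mor C S (Sextuple A B D f g h) (Sextuple A' B' D' f' g' h')
      (Cmp C A A2 A' a' (Cmp C A A1 A2 \<alpha>2 i)) (Cmp C B B2 B' b' (Cmp C B B1 B2 \<beta>2 j))
      (Cmp C D D2 D' c' (Cmp C D D1 D2 \<gamma>2 k))"
    using inv(1) t'(4)
    by (intro sextuple_mor_cmp[OF t(3) t'(2,3)] sextuple_mor_cmp[OF t(3,2) t'(2) _ g2])
      (simp_all only: sextuple_iso.simps)
  moreover have "Cmp C A A2 A' a' (Cmp C A A1 A2 \<alpha>2 i) = \<alpha>"
    unfolding \<alpha>2_def \<alpha>1_def by (rule conj_back) (use ob isos ab inv inv' in auto)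
  moreover have "Cmp C B B2 B' b' (Cmp C B B1 B2 \<beta>2 j) = \<beta>"
    unfolding \<beta>2_def \<beta>1_def by (rule conj_back) (use ob isos ab inv inv' in auto)
  ultimately show "\<exists>\<gamma> \<in> mor C D D'.
      sextuple_mor C S (Sextuple A B D f g h) (Sextuple A' B' D' f' g' h') \<alpha> \<beta> \<gamma>"
    by (auto simp only: sextuple_mor.simps)
qed

end


section \<open>Consecutive arrows of a right triangle\<close>

sublocale right_pretriangulated \<subseteq> suspended_category C S ..

context right_pretriangulated
begin

text \<open>
  Rotating \<open>0 \<rightarrow> A \<rightarrow> A \<rightarrow> \<Sigma>0\<close> gives a right triangle \<open>A \<rightarrow> A \<rightarrow> \<Sigma>0 \<rightarrow> \<Sigma>A\<close> whose first arrow is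
  the identity and whose second arrow is zero.  It maps to \<open>A \<rightarrow> B \<rightarrow> D \<rightarrow> \<Sigma>A\<close> by \<open>(1, f, \<gamma>)\<close>, so
  that \<open>g f\<close> factors through a zero arrow.
\<close>

lemma triangle_cmp_zero:
  assumes "Sextuple A B D f g h \<in> T"
  shows "Cmp C A B D g f = \<zero>\<^bsub>Hom C A D\<^esub>"
proof -
  have ob: "A \<in> Ob C" "B \<in> Ob C" "D \<in> Ob C" "f \<in> mor C A B" "g \<in> mor C B D"
    using triangles[OF assms] by simp_all
  obtain Z where Z: "zero_object C Z" using ex_zero_object by blast
  then have obZ: "Z \<in> Ob C" unfolding zero_object_def by blast
  let ?e = "\<zero>\<^bsub>Hom C A (Fob S Z)\<^esub>"
    and ?k = "\<ominus>\<^bsub>Hom C (Fob S Z) (Fob S A)\<^esub> Fmor S Z A \<zero>\<^bsub>Hom C Z A\<^esub>"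
  have "Sextuple Z A A \<zero>\<^bsub>Hom C Z A\<^esub> (Ident C A) ?e \<in> T"
    using rtr1 Z ob unfolding RTR1_def by blast
  then have "Sextuple A A (Fob S Z) (Ident C A) ?e ?k \<in> T"
    using rtr2 unfolding RTR2_def by blast
  then obtain \<gamma> where "sextuple_mor C S (Sextuple A A (Fob S Z) (Ident C A) ?e ?k)
      (Sextuple A B D f g h) (Ident C A) f \<gamma>"
    using rtr3 assms ident_mor ob unfolding RTR3_def by blast
  then have "\<gamma> \<in> mor C (Fob S Z) D" "Cmp C A (Fob S Z) D \<gamma> ?e = Cmp C A B D g f"
    by simp_all
  then show ?thesis using cmp_zero_right ob obZ fob by metis
qed

lemma triangle_cmp_zero':
  assumes "Sextuple A B D f g h \<in> T"
  shows "Cmp C B D (Fob S A) h g = \<zero>\<^bsub>Hom C B (Fob S A)\<^esub>"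
  using assms rtr2 triangle_cmp_zero unfolding RTR2_def by blast

end


section \<open>Subspaces along the functor\<close>

lemma subspaceI:
  assumes "vectorspace K V" "W \<subseteq> carrier V" "\<zero>\<^bsub>V\<^esub> \<in> W"
    and "\<And>v w. v \<in> W \<Longrightarrow> w \<in> W \<Longrightarrow> v \<oplus>\<^bsub>V\<^esub> w \<in> W"
    and "\<And>c v. c \<in> carrier K \<Longrightarrow> v \<in> W \<Longrightarrow> c \<odot>\<^bsub>V\<^esub> v \<in> W"
  shows "subspace K W V"
  using assms unfolding subspace_def LinearCombinations.submodule_def vectorspace_def by blast

lemma subspaceD:
  assumes "subspace K W V"
  shows "W \<subseteq> carrier V" "\<zero>\<^bsub>V\<^esub> \<in> W"
    and "v \<in> W \<Longrightarrow> w \<in> W \<Longrightarrow> v \<oplus>\<^bsub>V\<^esub> w \<in> W"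
    and "c \<in> carrier K \<Longrightarrow> v \<in> W \<Longrightarrow> c \<odot>\<^bsub>V\<^esub> v \<in> W"
  using LinearCombinations.submodule.subset LinearCombinations.submodule.zero_closed
    LinearCombinations.submodule.m_closed LinearCombinations.submodule.smult_closed
    subspace.submod[OF assms] by metis+

lemma subspace_neg_closed:
  assumes "subspace K W V" "v \<in> W"
  shows "\<ominus>\<^bsub>V\<^esub> v \<in> W"
proof -
  interpret V: vectorspace K V by (rule subspace.vs[OF assms(1)])
  have "\<ominus>\<^bsub>V\<^esub> v = (\<ominus>\<^bsub>K\<^esub> \<one>\<^bsub>K\<^esub>) \<odot>\<^bsub>V\<^esub> v"
    using V.smult_minus_1[of v] subspaceD(1)[OF assms(1)] assms(2) by (simp add: subset_iff)
  then show ?thesis using subspaceD(4)[OF assms(1)] assms(2) by simp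
qed

lemma zero_subspace: "vectorspace K V \<Longrightarrow> subspace K {\<zero>\<^bsub>V\<^esub>} V"
proof (rule subspaceI)
  assume "vectorspace K V"
  then interpret V: vectorspace K V .
  show "{\<zero>\<^bsub>V\<^esub>} \<subseteq> carrier V" by simp
  show "v \<oplus>\<^bsub>V\<^esub> w \<in> {\<zero>\<^bsub>V\<^esub>}" if "v \<in> {\<zero>\<^bsub>V\<^esub>}" "w \<in> {\<zero>\<^bsub>V\<^esub>}" for v w using that by simp
  show "c \<odot>\<^bsub>V\<^esub> v \<in> {\<zero>\<^bsub>V\<^esub>}" if "c \<in> carrier K" "v \<in> {\<zero>\<^bsub>V\<^esub>}" for c v
    using that V.rmult_0 by simp
qed auto

locale decoration = additive_category C + F: additive_functor C "fdVect K" F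
  for K :: "('k, 'r) ring_scheme" and C :: "('o, 'm) cat"
    and F :: "('o, 'm, 'k, 'v) vect_func"
begin

lemma vectorspace_F: "A \<in> Ob C \<Longrightarrow> vectorspace K (Fob F A)"
  using F.fob[of A] by (simp add: fdVect_def)

lemma zero_subspace_F: "A \<in> Ob C \<Longrightarrow> subspace K {\<zero>\<^bsub>Fob F A\<^esub>} (Fob F A)"
  by (rule zero_subspace[OF vectorspace_F])

lemma linear_F:
  assumes "A \<in> Ob C" "B \<in> Ob C" "f \<in> mor C A B"
  shows "Fmor F A B f \<in> module_hom K (Fob F A) (Fob F B)"
  using F.fmor[OF assms] by (simp add: fdVect_def)

lemma F_closed:
  assumes "A \<in> Ob C" "B \<in> Ob C" "f \<in> mor C A B" "x \<in> carrier (Fob F A)"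
  shows "Fmor F A B f x \<in> carrier (Fob F B)"
  using linear_F[OF assms(1-3)] assms(4) unfolding module_hom_def by blast

lemma F_ident: "A \<in> Ob C \<Longrightarrow> x \<in> carrier (Fob F A) \<Longrightarrow> Fmor F A A (Ident C A) x = x"
  by (simp add: F.fmor_ident fdVect_def)

lemma F_cmp:
  assumes "A \<in> Ob C" "B \<in> Ob C" "D \<in> Ob C" "f \<in> mor C A B" "g \<in> mor C B D"
    and "x \<in> carrier (Fob F A)"
  shows "Fmor F A D (Cmp C A B D g f) x = Fmor F B D g (Fmor F A B f x)"
  using assms by (simp add: F.fmor_cmp fdVect_def compose_def)

lemma F_add:
  assumes "A \<in> Ob C" "B \<in> Ob C" "f \<in> mor C A B" "g \<in> mor C A B" "x \<in> carrier (Fob F A)"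
  shows "Fmor F A B (f \<oplus>\<^bsub>Hom C A B\<^esub> g) x = Fmor F A B f x \<oplus>\<^bsub>Fob F B\<^esub> Fmor F A B g x"
  using assms by (simp add: F.fmor_add fdVect_def)

lemma F_zero:
  assumes "A \<in> Ob C" "B \<in> Ob C" "x \<in> carrier (Fob F A)"
  shows "Fmor F A B \<zero>\<^bsub>Hom C A B\<^esub> x = \<zero>\<^bsub>Fob F B\<^esub>"
proof -
  interpret AB: abelian_group "Hom C A B" using assms hom_group by blast
  interpret FB: vectorspace K "Fob F B" using assms vectorspace_F by blast
  let ?z = "Fmor F A B \<zero>\<^bsub>Hom C A B\<^esub> x"
  have "?z \<in> carrier (Fob F B)" using assms F_closed zero_mor by blast
  moreover have "?z \<oplus>\<^bsub>Fob F B\<^esub> ?z = ?z"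
    using F_add[OF assms(1,2) AB.zero_closed AB.zero_closed assms(3)] by simp
  ultimately show ?thesis by (metis FB.add.l_cancel_one)
qed

lemma F_neg:
  assumes "A \<in> Ob C" "B \<in> Ob C" "f \<in> mor C A B" "x \<in> carrier (Fob F A)"
  shows "Fmor F A B (\<ominus>\<^bsub>Hom C A B\<^esub> f) x = \<ominus>\<^bsub>Fob F B\<^esub> Fmor F A B f x"
proof -
  interpret AB: abelian_group "Hom C A B" using assms hom_group by blast
  interpret FB: vectorspace K "Fob F B" using assms vectorspace_F by blast
  have "Fmor F A B (\<ominus>\<^bsub>Hom C A B\<^esub> f) x \<oplus>\<^bsub>Fob F B\<^esub> Fmor F A B f x = \<zero>\<^bsub>Fob F B\<^esub>"
    using F_add[of A B "\<ominus>\<^bsub>Hom C A B\<^esub> f" f x] F_zero assms by (simp add: AB.l_neg)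
  then show ?thesis using FB.minus_equality F_closed assms by simp
qed

lemma F_zero_vector:
  assumes "A \<in> Ob C" "B \<in> Ob C" "f \<in> mor C A B"
  shows "Fmor F A B f \<zero>\<^bsub>Fob F A\<^esub> = \<zero>\<^bsub>Fob F B\<^esub>"
proof -
  interpret FA: vectorspace K "Fob F A" using assms vectorspace_F by blast
  interpret FB: vectorspace K "Fob F B" using assms vectorspace_F by blast
  have "Fmor F A B f (\<zero>\<^bsub>Fob F A\<^esub> \<oplus>\<^bsub>Fob F A\<^esub> \<zero>\<^bsub>Fob F A\<^esub>)
      = Fmor F A B f \<zero>\<^bsub>Fob F A\<^esub> \<oplus>\<^bsub>Fob F B\<^esub> Fmor F A B f \<zero>\<^bsub>Fob F A\<^esub>"
    using linear_F[OF assms] unfolding module_hom_def by blast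
  then show ?thesis
    using F_closed[OF assms FA.zero_closed] by (metis FA.zero_closed FA.r_zero FB.add.l_cancel_one)
qed

lemma subspace_image:
  assumes "A \<in> Ob C" "B \<in> Ob C" "f \<in> mor C A B" "subspace K U (Fob F A)"
  shows "subspace K (Fmor F A B f ` U) (Fob F B)"
proof (rule subspaceI)
  note U = subspaceD[OF assms(4)]
  have lin: "Fmor F A B f (x \<oplus>\<^bsub>Fob F A\<^esub> y) = Fmor F A B f x \<oplus>\<^bsub>Fob F B\<^esub> Fmor F A B f y"
    "c \<in> carrier K \<Longrightarrow> Fmor F A B f (c \<odot>\<^bsub>Fob F A\<^esub> x) = c \<odot>\<^bsub>Fob F B\<^esub> Fmor F A B f x"
    if "x \<in> U" "y \<in> U" for x y c
    using linear_F[OF assms(1-3)] subsetD[OF U(1)] that unfolding module_hom_def by auto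
  show "vectorspace K (Fob F B)" using vectorspace_F assms by blast
  show "Fmor F A B f ` U \<subseteq> carrier (Fob F B)" using F_closed[OF assms(1-3)] U(1) by blast
  show "\<zero>\<^bsub>Fob F B\<^esub> \<in> Fmor F A B f ` U" using F_zero_vector[OF assms(1-3)] U(2) by force
  show "v \<oplus>\<^bsub>Fob F B\<^esub> w \<in> Fmor F A B f ` U"
    if "v \<in> Fmor F A B f ` U" "w \<in> Fmor F A B f ` U" for v w
    using that U(3) lin(1) by (smt (verit) image_iff)
  show "c \<odot>\<^bsub>Fob F B\<^esub> v \<in> Fmor F A B f ` U"
    if "c \<in> carrier K" "v \<in> Fmor F A B f ` U" for c v
    using that U(4) lin(2) by (smt (verit) image_iff)
qed

lemma subspace_common_preimage:
  assumes "P \<in> Ob C" "A \<in> Ob C" "B \<in> Ob C" "p \<in> mor C P A" "q \<in> mor C P B"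
    and "subspace K U (Fob F A)" "subspace K V (Fob F B)"
  shows "subspace K {w \<in> carrier (Fob F P). Fmor F P A p w \<in> U \<and> Fmor F P B q w \<in> V} (Fob F P)"
proof -
  interpret FP: vectorspace K "Fob F P" using assms vectorspace_F by blast
  note lin = linear_F[OF assms(1,2,4)] linear_F[OF assms(1,3,5)]
  show ?thesis
    using vectorspace_F[OF assms(1)] lin F_zero_vector[OF assms(1,2,4)] F_zero_vector[OF assms(1,3,5)]
      subspaceD[OF assms(6)] subspaceD[OF assms(7)]
    by (intro subspaceI) (auto simp: module_hom_def)
qed


section \<open>The decorated category is additive\<close>

abbreviation \<D> where "\<D> \<equiv> Dec K C F"

lemma Ob_Dec [simp]: "(X, U) \<in> Ob \<D> \<longleftrightarrow> X \<in> Ob C \<and> subspace K U (Fob F X)"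
  by (simp add: Dec_def)

lemma mor_Dec [simp]: "f \<in> mor \<D> (X, U) (Y, V) \<longleftrightarrow> f \<in> mor C X Y \<and> Fmor F X Y f ` U \<subseteq> V"
  by (simp add: Dec_def)

lemma Cmp_Dec [simp]: "Cmp \<D> (X, U) (Y, V) (Z, W) g f = Cmp C X Y Z g f"
  by (simp add: Dec_def)

lemma Ident_Dec [simp]: "Ident \<D> (X, U) = Ident C X"
  by (simp add: Dec_def)

lemma zero_Dec [simp]: "\<zero>\<^bsub>Hom \<D> (X, U) (Y, V)\<^esub> = \<zero>\<^bsub>Hom C X Y\<^esub>"
  by (simp add: Dec_def)

lemma add_Dec [simp]: "f \<oplus>\<^bsub>Hom \<D> (X, U) (Y, V)\<^esub> g = f \<oplus>\<^bsub>Hom C X Y\<^esub> g"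
  by (simp add: Dec_def)

lemma in_carrier: "subspace K U (Fob F X) \<Longrightarrow> u \<in> U \<Longrightarrow> u \<in> carrier (Fob F X)"
  using subspaceD(1) by blast

lemma Dec_hom_group:
  assumes "(X, U) \<in> Ob \<D>" "(Y, V) \<in> Ob \<D>"
  shows "abelian_group (Hom \<D> (X, U) (Y, V))"
proof -
  have X: "X \<in> Ob C" "subspace K U (Fob F X)" and Y: "Y \<in> Ob C" "subspace K V (Fob F Y)"
    using assms by simp_all
  interpret XY: abelian_group "Hom C X Y" using X Y hom_group by blast
  show ?thesis
  proof (rule abelian_groupI)
    show "f \<oplus>\<^bsub>Hom \<D> (X, U) (Y, V)\<^esub> g \<in> mor \<D> (X, U) (Y, V)"
      if "f \<in> mor \<D> (X, U) (Y, V)" "g \<in> mor \<D> (X, U) (Y, V)" for f g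
      using that X Y in_carrier[OF X(2)] subspaceD(3)[OF Y(2)]
      by (auto simp: F_add image_subset_iff)
    show "\<zero>\<^bsub>Hom \<D> (X, U) (Y, V)\<^esub> \<in> mor \<D> (X, U) (Y, V)"
      using X Y in_carrier[OF X(2)] subspaceD(2)[OF Y(2)] F_zero by auto
    show "\<exists>g \<in> mor \<D> (X, U) (Y, V).
        g \<oplus>\<^bsub>Hom \<D> (X, U) (Y, V)\<^esub> f = \<zero>\<^bsub>Hom \<D> (X, U) (Y, V)\<^esub>"
      if "f \<in> mor \<D> (X, U) (Y, V)" for f
      using that X Y in_carrier[OF X(2)] subspace_neg_closed[OF Y(2)] F_neg
      by (intro bexI[of _ "\<ominus>\<^bsub>Hom C X Y\<^esub> f"]) (auto simp: XY.l_neg image_subset_iff)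
    show "f \<oplus>\<^bsub>Hom \<D> (X, U) (Y, V)\<^esub> g = g \<oplus>\<^bsub>Hom \<D> (X, U) (Y, V)\<^esub> f"
      if "f \<in> mor \<D> (X, U) (Y, V)" "g \<in> mor \<D> (X, U) (Y, V)" for f g
      using that by (simp add: XY.a_comm)
  qed (simp_all add: XY.a_assoc)
qed

lemma neg_Dec:
  assumes "(X, U) \<in> Ob \<D>" "(Y, V) \<in> Ob \<D>" "f \<in> mor \<D> (X, U) (Y, V)"
  shows "\<ominus>\<^bsub>Hom \<D> (X, U) (Y, V)\<^esub> f = \<ominus>\<^bsub>Hom C X Y\<^esub> f"
proof -
  interpret XY: abelian_group "Hom C X Y" using assms hom_group by simp
  interpret H: abelian_group "Hom \<D> (X, U) (Y, V)" using assms Dec_hom_group by blast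
  have "\<ominus>\<^bsub>Hom \<D> (X, U) (Y, V)\<^esub> f \<oplus>\<^bsub>Hom C X Y\<^esub> f = \<zero>\<^bsub>Hom C X Y\<^esub>"
    using H.l_neg[OF assms(3)] by simp
  moreover have "\<ominus>\<^bsub>Hom \<D> (X, U) (Y, V)\<^esub> f \<in> mor C X Y"
    using H.a_inv_closed[OF assms(3)] by simp
  moreover have "f \<in> mor C X Y" using assms(3) by simp
  ultimately show ?thesis using XY.minus_equality[of "\<ominus>\<^bsub>Hom \<D> (X, U) (Y, V)\<^esub> f" f] by simp
qed

lemma Dec_preadditive: "preadditive_category \<D>"
proof (rule preadditive_category.intro, unfold split_paired_all, goal_cases)
  case (1 X U Y V) then show ?case by (rule Dec_hom_group)
next
  case (2 X U)
  then have "Fmor F X X (Ident C X) u = u" if "u \<in> U" for u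
    using that F_ident in_carrier[of U X u] by simp
  with 2 show ?case by (simp add: ident_mor)
next
  case (3 X U Y V Z W f g)
  then have "Fmor F X Z (Cmp C X Y Z g f) u = Fmor F Y Z g (Fmor F X Y f u)" if "u \<in> U" for u
    using that F_cmp in_carrier[of U X u] by simp
  with 3 show ?case by (simp add: cmp_mor image_subset_iff)
qed (simp_all add: ident_left ident_right cmp_assoc cmp_add_left cmp_add_right)

sublocale Dec: preadditive_category \<D> by (rule Dec_preadditive)

text \<open>
  The decoration of a zero object is forced: \<open>F\<close> maps the identity, which is zero, to both the
  identity and the zero map of \<open>F(Z)\<close>.
\<close>

lemma zero_object_Dec_iff:
  "zero_object \<D> (Z, W) \<longleftrightarrow> zero_object C Z \<and> W = {\<zero>\<^bsub>Fob F Z\<^esub>}"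
proof
  assume "zero_object \<D> (Z, W)"
  then have Z: "Z \<in> Ob C" "subspace K W (Fob F Z)" "Ident C Z = \<zero>\<^bsub>Hom C Z Z\<^esub>"
    unfolding Dec.zero_object_iff by simp_all
  have "w = \<zero>\<^bsub>Fob F Z\<^esub>" if "w \<in> W" for w
    using F_ident F_zero in_carrier Z that by metis
  then show "zero_object C Z \<and> W = {\<zero>\<^bsub>Fob F Z\<^esub>}"
    using Z subspaceD(2) zero_object_iff by blast
next
  assume "zero_object C Z \<and> W = {\<zero>\<^bsub>Fob F Z\<^esub>}"
  then show "zero_object \<D> (Z, W)"
    unfolding Dec.zero_object_iff zero_object_iff
    by (simp add: zero_subspace_F)
qed

text \<open>
  The decoration of the biproduct is \<open>U \<oplus> V\<close>, described by projections rather than as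
  \<open>F(i1)U + F(i2)V\<close>: the projections then respect it by definition, and for the injections it
  suffices to know the composites \<open>p i\<close>.
\<close>

lemma biproduct_Dec:
  assumes "(X, U) \<in> Ob \<D>" "(Y, V) \<in> Ob \<D>" "is_biproduct C X Y P i1 i2 p1 p2"
  defines "W \<equiv> {w \<in> carrier (Fob F P). Fmor F P X p1 w \<in> U \<and> Fmor F P Y p2 w \<in> V}"
  shows "is_biproduct \<D> (X, U) (Y, V) (P, W) i1 i2 p1 p2"
proof -
  have X: "X \<in> Ob C" "subspace K U (Fob F X)" and Y: "Y \<in> Ob C" "subspace K V (Fob F Y)"
    using assms by simp_all
  have P: "P \<in> Ob C" "i1 \<in> mor C X P" "i2 \<in> mor C Y P" "p1 \<in> mor C P X" "p2 \<in> mor C P Y"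
    and eqs: "Cmp C X P X p1 i1 = Ident C X" "Cmp C Y P Y p2 i2 = Ident C Y"
      "Cmp C X P Y p2 i1 = \<zero>\<^bsub>Hom C X Y\<^esub>" "Cmp C Y P X p1 i2 = \<zero>\<^bsub>Hom C Y X\<^esub>"
      "Cmp C P X P i1 p1 \<oplus>\<^bsub>Hom C P P\<^esub> Cmp C P Y P i2 p2 = Ident C P"
    using assms(3) unfolding is_biproduct_def by blast+
  have "Fmor F X P i1 u \<in> W" if "u \<in> U" for u
  proof -
    have u: "u \<in> carrier (Fob F X)" using in_carrier[OF X(2) that] .
    have "Fmor F P X p1 (Fmor F X P i1 u) = u" "Fmor F P Y p2 (Fmor F X P i1 u) = \<zero>\<^bsub>Fob F Y\<^esub>"
      using X Y P u by (simp_all add: F_cmp[symmetric] eqs F_ident F_zero)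
    then show ?thesis
      using that F_closed[OF X(1) P(1,2) u] subspaceD(2)[OF Y(2)] by (simp add: W_def)
  qed
  moreover have "Fmor F Y P i2 v \<in> W" if "v \<in> V" for v
  proof -
    have v: "v \<in> carrier (Fob F Y)" using in_carrier[OF Y(2) that] .
    have "Fmor F P Y p2 (Fmor F Y P i2 v) = v" "Fmor F P X p1 (Fmor F Y P i2 v) = \<zero>\<^bsub>Fob F X\<^esub>"
      using X Y P v by (simp_all add: F_cmp[symmetric] eqs F_ident F_zero)
    then show ?thesis
      using that F_closed[OF Y(1) P(1,3) v] subspaceD(2)[OF X(2)] by (simp add: W_def)
  qed
  moreover have "subspace K W (Fob F P)"
    unfolding W_def using subspace_common_preimage X Y P by blast
  moreover have "Fmor F P X p1 ` W \<subseteq> U" "Fmor F P Y p2 ` W \<subseteq> V"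
    unfolding W_def by auto
  ultimately show ?thesis
    using P eqs unfolding is_biproduct_def by auto
qed

lemma Dec_additive: "additive_category \<D>"
proof (intro additive_category.intro additive_category_axioms.intro Dec_preadditive, goal_cases)
  case 1
  obtain Z where "zero_object C Z" using ex_zero_object ..
  then have "zero_object \<D> (Z, {\<zero>\<^bsub>Fob F Z\<^esub>})" by (simp add: zero_object_Dec_iff)
  then show ?case ..
next
  case (2 A B)
  obtain X U Y V where AB: "A = (X, U)" "B = (Y, V)" by (cases A; cases B)
  with 2 have "X \<in> Ob C" "Y \<in> Ob C" by simp_all
  then obtain P i1 i2 p1 p2 where "is_biproduct C X Y P i1 i2 p1 p2"
    using ex_biproduct by blast
  from biproduct_Dec[OF 2[unfolded AB] this] show ?case unfolding AB by blast
qed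

end


section \<open>Triangles of the decorated category\<close>

lemma decorated_trianglesI:
  assumes "Sextuple X Y Z f g h \<in> T" "subspace K U (Fob F X)" "subspace K V (Fob F Y)"
    and "Fmor F X Y f ` U \<subseteq> V" "W = Fmor F Y Z g ` V"
  shows "Sextuple (X, U) (Y, V) (Z, W) f g h \<in> decorated_triangles K F T"
  using assms unfolding decorated_triangles_def by blast

lemma decorated_trianglesD:
  assumes "Sextuple (X, U) (Y, V) (Z, W) f g h \<in> decorated_triangles K F T"
  shows "Sextuple X Y Z f g h \<in> T" "subspace K U (Fob F X)" "subspace K V (Fob F Y)"
    and "Fmor F X Y f ` U \<subseteq> V" "W = Fmor F Y Z g ` V"
  using assms unfolding decorated_triangles_def by blast+

locale decorated_right_pretriangulated = decoration K C F + right_pretriangulated C S T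
  for K :: "('k, 'r) ring_scheme" and C :: "('o, 'm) cat" and F :: "('o, 'm, 'k, 'v) vect_func"
    and S :: "('o, 'm) endofunc" and T :: "('o, 'm) sextuple set"
begin

abbreviation \<S> where "\<S> \<equiv> Dec_susp F S"

lemma Fob_susp [simp]: "Fob \<S> (X, U) = (Fob S X, {\<zero>\<^bsub>Fob F (Fob S X)\<^esub>})"
  by (simp add: Dec_susp_def)

lemma Fmor_susp [simp]: "Fmor \<S> (X, U) (Y, V) f = Fmor S X Y f"
  by (simp add: Dec_susp_def)

lemma susp_Ob: "X \<in> Ob C \<Longrightarrow> (Fob S X, {\<zero>\<^bsub>Fob F (Fob S X)\<^esub>}) \<in> Ob \<D>"
  using fob zero_subspace_F by simp

lemma susp_mor:
  "X \<in> Ob C \<Longrightarrow> Y \<in> Ob C \<Longrightarrow> f \<in> mor C X Y \<Longrightarrow> Fmor S X Y f \<in>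
    mor \<D> (Fob S X, {\<zero>\<^bsub>Fob F (Fob S X)\<^esub>}) (Fob S Y, {\<zero>\<^bsub>Fob F (Fob S Y)\<^esub>})"
  using fob fmor F_zero_vector by simp

lemma Dec_susp_functor: "additive_functor \<D> \<D> \<S>"
  by (rule additive_functor.intro, unfold split_paired_all)
    (simp_all only: Ob_Dec mor_Dec Cmp_Dec Ident_Dec add_Dec Fob_susp Fmor_susp
      fmor_ident fmor_cmp fmor_add susp_Ob[unfolded Ob_Dec] susp_mor[unfolded mor_Dec] simp_thms)

sublocale Dec: suspended_category \<D> \<S>
  by (intro suspended_category.intro Dec_preadditive Dec_susp_functor)

lemma Dec_triangles_eq: "Dec_triangles K C F S T = Dec.iso_closure (decorated_triangles K F T)"
  unfolding Dec_triangles_def Dec.iso_closure_def ..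

text \<open>
  Because \<open>h g = 0\<close>.  This serves twice: it makes the third arrow of a generating triangle respect the
  decorations, and it identifies the decoration of \<open>\<Sigma>X\<close> in the rotated triangle.
\<close>

lemma triangle_image_zero:
  assumes "Sextuple X Y Z f g h \<in> T" "subspace K V (Fob F Y)"
  shows "Fmor F Z (Fob S X) h ` Fmor F Y Z g ` V = {\<zero>\<^bsub>Fob F (Fob S X)\<^esub>}"
proof -
  have ob: "X \<in> Ob C" "Y \<in> Ob C" "Z \<in> Ob C" "g \<in> mor C Y Z" "h \<in> mor C Z (Fob S X)"
    using triangles[OF assms(1)] by simp_all
  have "Fmor F Z (Fob S X) h (Fmor F Y Z g v) = \<zero>\<^bsub>Fob F (Fob S X)\<^esub>" if "v \<in> V" for v
    using F_cmp[of Y Z "Fob S X" g h v] in_carrier[OF assms(2) that] ob fob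
      triangle_cmp_zero'[OF assms(1)] F_zero by simp
  then have "Fmor F Z (Fob S X) h ` Fmor F Y Z g ` V = (\<lambda>v. \<zero>\<^bsub>Fob F (Fob S X)\<^esub>) ` V"
    unfolding image_image by (rule image_cong[OF refl])
  then show ?thesis using subspaceD(2)[OF assms(2)] by auto
qed

lemma decorated_triangle_is_sextuple:
  assumes "s \<in> decorated_triangles K F T"
  shows "is_sextuple \<D> \<S> s"
proof -
  obtain X U Y V Z f g h where s: "s = Sextuple (X, U) (Y, V) (Z, Fmor F Y Z g ` V) f g h"
    and t: "Sextuple X Y Z f g h \<in> T" "subspace K U (Fob F X)" "subspace K V (Fob F Y)"
      "Fmor F X Y f ` U \<subseteq> V"
    using assms unfolding decorated_triangles_def mem_Collect_eq by (elim exE conjE) (rule that)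
  have ob: "X \<in> Ob C" "Y \<in> Ob C" "Z \<in> Ob C" "f \<in> mor C X Y" "g \<in> mor C Y Z"
      "h \<in> mor C Z (Fob S X)"
    using triangles[OF t(1)] by simp_all
  then show ?thesis
    using t subspace_image[OF ob(2,3,5) t(3)]
    by (simp add: s fob zero_subspace_F triangle_image_zero[OF t(1,3)])
qed

lemma decorated_in_Dec_triangles:
  "s \<in> decorated_triangles K F T \<Longrightarrow> s \<in> Dec_triangles K C F S T"
  unfolding Dec_triangles_eq by (simp add: Dec.in_iso_closure decorated_triangle_is_sextuple)

lemma is_iso_Dec_imp: "is_iso \<D> (X, U) (Y, V) f \<Longrightarrow> is_iso C X Y f"
  unfolding is_iso_def by auto

text \<open>
  A decorated triangle is isomorphic to a generating one, and forgetting decorations turns this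
  isomorphism into one in \<open>C\<close>, under which \<open>T\<close> is closed.
\<close>

lemma Dec_triangle_underlying:
  assumes "Sextuple (X, U) (Y, V) (Z, W) f g h \<in> Dec_triangles K C F S T"
  shows "Sextuple X Y Z f g h \<in> T"
proof -
  obtain A B D f' g' h' \<alpha> \<beta> \<gamma> where s: "Sextuple A B D f' g' h' \<in> decorated_triangles K F T"
    and t: "is_sextuple \<D> \<S> (Sextuple A B D f' g' h')"
      "is_sextuple \<D> \<S> (Sextuple (X, U) (Y, V) (Z, W) f g h)"
      "sextuple_iso \<D> \<S> (Sextuple A B D f' g' h') (Sextuple (X, U) (Y, V) (Z, W) f g h) \<alpha> \<beta> \<gamma>"
    using assms unfolding Dec_triangles_eq by (rule Dec.iso_closure_cases)
  obtain X' U' Y' V' Z' W' where ABD: "A = (X', U')" "B = (Y', V')" "D = (Z', W')"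
    by (cases A; cases B; cases D)
  have "sextuple_iso C S (Sextuple X' Y' Z' f' g' h') (Sextuple X Y Z f g h) \<alpha> \<beta> \<gamma>"
    using t(3) is_iso_Dec_imp unfolding ABD by auto
  moreover have "is_sextuple C S (Sextuple X' Y' Z' f' g' h')" "is_sextuple C S (Sextuple X Y Z f g h)"
    using t(1,2) unfolding ABD by simp_all
  ultimately have "sextuples_isomorphic C S (Sextuple X' Y' Z' f' g' h') (Sextuple X Y Z f g h)"
    unfolding sextuples_isomorphic_def by blast
  then show ?thesis
    using decorated_trianglesD(1)[OF s[unfolded ABD]] rtr1 unfolding RTR1_def by blast
qed

lemma RTR1_Dec: "RTR1 \<D> \<S> (Dec_triangles K C F S T)"
  unfolding RTR1_def
proof (intro conjI allI impI; (elim conjE)?)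
  fix s t
  assume "s \<in> Dec_triangles K C F S T" "sextuples_isomorphic \<D> \<S> s t"
  then show "t \<in> Dec_triangles K C F S T"
    unfolding Dec_triangles_eq by (rule Dec.iso_closure_closed)
next
  fix Z' A'
  assume Z: "zero_object \<D> Z'" and A: "A' \<in> Ob \<D>"
  obtain Z W A U where ZA: "Z' = (Z, W)" "A' = (A, U)" by (cases Z'; cases A')
  have obZ: "zero_object C Z" "Z \<in> Ob C" "W = {\<zero>\<^bsub>Fob F Z\<^esub>}"
    using Z unfolding ZA zero_object_Dec_iff by (simp_all add: zero_object_iff)
  have obA: "A \<in> Ob C" "subspace K U (Fob F A)" using A unfolding ZA by simp_all
  have "Sextuple Z A A \<zero>\<^bsub>Hom C Z A\<^esub> (Ident C A) \<zero>\<^bsub>Hom C A (Fob S Z)\<^esub> \<in> T"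
    using rtr1 obZ obA unfolding RTR1_def by blast
  moreover have "Fmor F Z A \<zero>\<^bsub>Hom C Z A\<^esub> ` W \<subseteq> U"
    using obZ obA F_zero_vector zero_mor subspaceD(2)[OF obA(2)] by simp
  moreover have "U = Fmor F A A (Ident C A) ` U"
    using obA in_carrier[OF obA(2)] by (simp add: F_ident)
  ultimately show "Sextuple Z' A' A' \<zero>\<^bsub>Hom \<D> Z' A'\<^esub> (Ident \<D> A') \<zero>\<^bsub>Hom \<D> A' (Fob \<S> Z')\<^esub>
      \<in> Dec_triangles K C F S T"
    unfolding ZA zero_Dec Ident_Dec Fob_susp
    by (intro decorated_in_Dec_triangles decorated_trianglesI)
      (use obZ obA zero_subspace_F in auto)
next
  fix A B f
  assume AB: "A \<in> Ob \<D>" "B \<in> Ob \<D>" "f \<in> mor \<D> A B"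
  obtain X U Y V where XY: "A = (X, U)" "B = (Y, V)" by (cases A; cases B)
  then have "X \<in> Ob C" "Y \<in> Ob C" "f \<in> mor C X Y" using AB by simp_all
  then obtain Z g h where "Sextuple X Y Z f g h \<in> T"
    using rtr1 unfolding RTR1_def by blast
  then have "Sextuple A B (Z, Fmor F Y Z g ` V) f g h \<in> Dec_triangles K C F S T"
    unfolding XY
    by (intro decorated_in_Dec_triangles decorated_trianglesI) (use AB XY in auto)
  then show "\<exists>D g h. Sextuple A B D f g h \<in> Dec_triangles K C F S T" by blast
qed

lemma RTR2_Dec: "RTR2 \<D> \<S> (Dec_triangles K C F S T)"
  unfolding Dec_triangles_eq
proof (rule Dec.RTR2_iso_closure)
  fix A B D f g h
  assume s: "Sextuple A B D f g h \<in> decorated_triangles K F T"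
  obtain X U Y V Z W where ABD: "A = (X, U)" "B = (Y, V)" "D = (Z, W)"
    by (cases A; cases B; cases D)
  note t = decorated_trianglesD[OF s[unfolded ABD]]
  have ob: "X \<in> Ob C" "Y \<in> Ob C" "Z \<in> Ob C" "f \<in> mor C X Y" "g \<in> mor C Y Z"
    using triangles[OF t(1)] by simp_all
  have neg: "\<ominus>\<^bsub>Hom \<D> (Fob \<S> A) (Fob \<S> B)\<^esub> Fmor \<S> A B f
      = \<ominus>\<^bsub>Hom C (Fob S X) (Fob S Y)\<^esub> Fmor S X Y f"
    unfolding ABD Fob_susp Fmor_susp
    using neg_Dec susp_Ob susp_mor ob by blast
  have "Sextuple Y Z (Fob S X) g h (\<ominus>\<^bsub>Hom C (Fob S X) (Fob S Y)\<^esub> Fmor S X Y f) \<in> T"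
    using rtr2 t(1) unfolding RTR2_def by blast
  then have "Sextuple B D (Fob \<S> A) g h (\<ominus>\<^bsub>Hom \<D> (Fob \<S> A) (Fob \<S> B)\<^esub> Fmor \<S> A B f)
      \<in> decorated_triangles K F T"
    unfolding neg unfolding ABD Fob_susp
    by (intro decorated_trianglesI)
      (use t ob subspace_image triangle_image_zero[OF t(1,3)] in simp_all)
  then show "Sextuple B D (Fob \<S> A) g h (\<ominus>\<^bsub>Hom \<D> (Fob \<S> A) (Fob \<S> B)\<^esub> Fmor \<S> A B f)
      \<in> Dec.iso_closure (decorated_triangles K F T)"
    using decorated_in_Dec_triangles unfolding Dec_triangles_eq by blast
qed

text \<open>
  A filler \<open>\<gamma>\<close> in the underlying category respects the decorations \<open>F(g)V\<close> and \<open>F(g')V'\<close>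
  because \<open>F(\<gamma>)F(g)V = F(g')F(\<beta>)V \<subseteq> F(g')V'\<close>.
\<close>

lemma RTR3_decorated_triangles: "RTR3 \<D> \<S> (decorated_triangles K F T)"
  unfolding RTR3_def
proof (intro allI impI, elim conjE)
  fix A B D f g h A' B' D' f' g' h' \<alpha> \<beta>
  assume s: "Sextuple A B D f g h \<in> decorated_triangles K F T"
    and s': "Sextuple A' B' D' f' g' h' \<in> decorated_triangles K F T"
    and ab: "\<alpha> \<in> mor \<D> A A'" "\<beta> \<in> mor \<D> B B'"
    and sq: "Cmp \<D> A B B' \<beta> f = Cmp \<D> A A' B' f' \<alpha>"
  obtain X U Y V Z W where ABD: "A = (X, U)" "B = (Y, V)" "D = (Z, W)"
    by (cases A; cases B; cases D)
  obtain X' U' Y' V' Z' W' where ABD': "A' = (X', U')" "B' = (Y', V')" "D' = (Z', W')"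
    by (cases A'; cases B'; cases D')
  note t = decorated_trianglesD[OF s[unfolded ABD]]
  note t' = decorated_trianglesD[OF s'[unfolded ABD']]
  have "\<alpha> \<in> mor C X X'" "\<beta> \<in> mor C Y Y'" "Cmp C X Y Y' \<beta> f = Cmp C X X' Y' f' \<alpha>"
    using ab sq unfolding ABD ABD' by simp_all
  then obtain \<gamma> where \<gamma>:
    "sextuple_mor C S (Sextuple X Y Z f g h) (Sextuple X' Y' Z' f' g' h') \<alpha> \<beta> \<gamma>"
    using rtr3 t(1) t'(1) unfolding RTR3_def by blast
  have "Fmor F Z Z' \<gamma> w \<in> W'" if w: "w \<in> W" for w
  proof -
    obtain v where v: "v \<in> V" "w = Fmor F Y Z g v" using w t(5) by blast
    have "v \<in> carrier (Fob F Y)" using in_carrier[OF t(3) v(1)] .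
    moreover have "Y \<in> Ob C" "Z \<in> Ob C" "Y' \<in> Ob C" "Z' \<in> Ob C"
        "g \<in> mor C Y Z" "g' \<in> mor C Y' Z'" "\<beta> \<in> mor C Y Y'" "\<gamma> \<in> mor C Z Z'"
      using \<gamma> triangles[OF t(1)] triangles[OF t'(1)] by simp_all
    ultimately have "Fmor F Z Z' \<gamma> w = Fmor F Y Z' (Cmp C Y Z Z' \<gamma> g) v"
        "Fmor F Y' Z' g' (Fmor F Y Y' \<beta> v) = Fmor F Y Z' (Cmp C Y Y' Z' g' \<beta>) v"
      by (simp_all add: v(2) F_cmp)
    then have "Fmor F Z Z' \<gamma> w = Fmor F Y' Z' g' (Fmor F Y Y' \<beta> v)"
      using \<gamma> by simp
    then show ?thesis using v ab(2) t'(5) unfolding ABD ABD' by auto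
  qed
  then have "\<gamma> \<in> mor \<D> D D'" using \<gamma> unfolding ABD ABD' by auto
  moreover have "sextuple_mor \<D> \<S> (Sextuple A B D f g h) (Sextuple A' B' D' f' g' h') \<alpha> \<beta> \<gamma>"
    using \<gamma> ab sq calculation unfolding ABD ABD' by simp
  ultimately show "\<exists>\<gamma> \<in> mor \<D> D D'.
      sextuple_mor \<D> \<S> (Sextuple A B D f g h) (Sextuple A' B' D' f' g' h') \<alpha> \<beta> \<gamma>" by blast
qed

lemma Dec_right_pretriangulated: "right_pretriangulated \<D> \<S> (Dec_triangles K C F S T)"
proof (intro right_pretriangulated.intro right_pretriangulated_axioms.intro
    Dec_additive Dec_susp_functor RTR1_Dec RTR2_Dec)
  show "is_sextuple \<D> \<S> t" if "t \<in> Dec_triangles K C F S T" for t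
    using that unfolding Dec_triangles_def sextuples_isomorphic_def by blast
  show "RTR3 \<D> \<S> (Dec_triangles K C F S T)"
    unfolding Dec_triangles_eq by (rule Dec.RTR3_iso_closure[OF RTR3_decorated_triangles])
qed


section \<open>The octahedral axiom\<close>

text \<open>
  On the decorations by zero every arrow of \<open>C\<close> is a decorated arrow, so \<open>X \<mapsto> (X, 0)\<close> is a full
  embedding; as \<open>F(g)0 = 0\<close>, it takes right triangles to generating triangles.
\<close>

abbreviation zero_dec where "zero_dec X \<equiv> (X, {\<zero>\<^bsub>Fob F X\<^esub>})"

lemma zero_dec_mor:
  "X \<in> Ob C \<Longrightarrow> Y \<in> Ob C \<Longrightarrow> f \<in> mor C X Y \<Longrightarrow> f \<in> mor \<D> (zero_dec X) (zero_dec Y)"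
  using F_zero_vector by simp

lemma zero_dec_triangle:
  assumes "Sextuple X Y Z f g h \<in> T"
  shows "Sextuple (zero_dec X) (zero_dec Y) (zero_dec Z) f g h \<in> Dec_triangles K C F S T"
  using assms triangles[OF assms] F_zero_vector zero_subspace_F
  by (intro decorated_in_Dec_triangles decorated_trianglesI) simp_all

lemma RTR4_underlying:
  assumes "RTR4 \<D> \<S> (Dec_triangles K C F S T)"
  shows "RTR4 C S T"
  unfolding RTR4_def
proof (intro allI impI, elim conjE)
  fix A B D X Y Z f g h a d e b c
  assume fa: "f \<in> mor C A B" "a \<in> mor C B X"
    and t: "Sextuple A B D f g h \<in> T" "Sextuple A X Y (Cmp C A B X a f) d e \<in> T"
      "Sextuple B X Z a b c \<in> T"
  have ob: "A \<in> Ob C" "B \<in> Ob C" "X \<in> Ob C"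
    using triangles[OF t(1)] triangles[OF t(3)] by simp_all
  have "f \<in> mor \<D> (zero_dec A) (zero_dec B)" "a \<in> mor \<D> (zero_dec B) (zero_dec X)"
    using zero_dec_mor ob fa by blast+
  moreover have "Sextuple (zero_dec A) (zero_dec X) (zero_dec Y)
      (Cmp \<D> (zero_dec A) (zero_dec B) (zero_dec X) a f) d e
      \<in> Dec_triangles K C F S T"
    using zero_dec_triangle[OF t(2)] by simp
  ultimately obtain s t' where st:
    "s \<in> mor \<D> (zero_dec D) (zero_dec Y)" "t' \<in> mor \<D> (zero_dec Y) (zero_dec Z)"
    "Cmp \<D> (zero_dec B) (zero_dec D) (zero_dec Y) s g
      = Cmp \<D> (zero_dec B) (zero_dec X) (zero_dec Y) d a"
    "Cmp \<D> (zero_dec D) (zero_dec Y) (Fob \<S> (zero_dec A)) e s = h"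
    "Cmp \<D> (zero_dec X) (zero_dec Y) (zero_dec Z) t' d = b"
    "Cmp \<D> (zero_dec Y) (zero_dec Z) (Fob \<S> (zero_dec B)) c t'
      = Cmp \<D> (zero_dec Y) (Fob \<S> (zero_dec A)) (Fob \<S> (zero_dec B))
        (Fmor \<S> (zero_dec A) (zero_dec B) f) e"
    "Sextuple (zero_dec D) (zero_dec Y) (zero_dec Z) s t'
      (Cmp \<D> (zero_dec Z) (Fob \<S> (zero_dec B)) (Fob \<S> (zero_dec D))
        (Fmor \<S> (zero_dec B) (zero_dec D) g) c)
      \<in> Dec_triangles K C F S T"
    using assms zero_dec_triangle[OF t(1)] zero_dec_triangle[OF t(3)] unfolding RTR4_def by meson
  note st = st[unfolded Fob_susp Fmor_susp Cmp_Dec mor_Dec]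
  show "\<exists>s \<in> mor C D Y. \<exists>t \<in> mor C Y Z.
      Cmp C B D Y s g = Cmp C B X Y d a \<and> Cmp C D Y (Fob S A) e s = h \<and>
      Cmp C X Y Z t d = b \<and>
      Cmp C Y Z (Fob S B) c t = Cmp C Y (Fob S A) (Fob S B) (Fmor S A B f) e \<and>
      Sextuple D Y Z s t (Cmp C Z (Fob S B) (Fob S D) (Fmor S B D g) c) \<in> T"
    using st(1-6) Dec_triangle_underlying[OF st(7)] by blast
qed

end

theorem proposition4p3:
  fixes K :: "('k, 'r) ring_scheme"
    and C :: "('o, 'm) cat"
    and S :: "('o, 'm) endofunc"
    and T :: "('o, 'm) sextuple set"
    and F :: "('o, 'm, 'k, 'v) vect_func"
  assumes "field K"
    and "right_pretriangulated C S T"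
    and "additive_functor C (fdVect K) F"
  shows "right_pretriangulated (Dec K C F) (Dec_susp F S) (Dec_triangles K C F S T) \<and>
    (RTR4 (Dec K C F) (Dec_susp F S) (Dec_triangles K C F S T) \<longrightarrow> RTR4 C S T)"
proof -
  interpret decorated_right_pretriangulated K C F S T
    using assms(2,3)
    by (intro decorated_right_pretriangulated.intro decoration.intro right_pretriangulated.axioms(1))
  show ?thesis using Dec_right_pretriangulated RTR4_underlying by blast
qed

end
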